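(* Every pair $(G,T)$, where $G$ is a connected graph and $T\subseteq V(G)$, satisfies exactly one of the following three properties, and each of the three properties is satisfied by at least one such pair (in other words, the class $\{(G,T) : G \text{ is a connected graph and } T\subseteq V(G)\}$ is partitioned into three nonempty subclasses defined by these properties): (A) $G$ contains a $T'$-join for every $T'\subseteq V(G)$ with $|T'\triangle T|<\infty$; (B) for every $T'\subseteq V(G)$ with $|T'\triangle T|$ finite, $G$ contains a $T'$-join if $|T'\triangle T|$ is even, and $G$ does not contain a $T'$-join if $|T'\triangle T|$ is odd; (C) for every $T'\subseteq V(G)$ with $|T'\triangle T|$ finite, $G$ contains a $T'$-join if $|T'\triangle T|$ is odd, and $G$ does not contain a $T'$-join if $|T'\triangle T|$ is even.
   Context: Graphs are undirected, may have multiple edges, have no loops, and may be finite or infinite of arbitrary cardinality; a connected graph has at least one vertex. Here $T'\triangle T=(T\setminus T')\cup(T'\setminus T)$ denotes the symmetric difference. Paths are finite. For a graph $G$ and $T\subseteq V(G)$ (finite or infinite, possibly empty), a $T$-join in $G$ is a system $\mathcal{P}$ of pairwise edge-disjoint finite paths in $G$ such that the sets of endvertices of the paths in $\mathcal{P}$ form a partition of $T$ into two-element sets (that is, every $v\in T$ is an endvertex of exactly one path of $\mathcal{P}$, and each path of $\mathcal{P}$ has two distinct endvertices, both in $T$). The empty system is a $\varnothing$-join. *)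

theory Defs
  imports Main
begin

text \<open>
  Undirected multigraphs: parallel edges are distinct elements of \<open>edges\<close> with the same
  set of ends; loops are excluded since an edge has exactly two ends.
\<close>

record ('v, 'e) multigraph =
  verts :: "'v set"
  edges :: "'e set"
  ends :: "'e \<Rightarrow> 'v set"

definition wf_multigraph :: "('v, 'e) multigraph \<Rightarrow> bool" where
  "wf_multigraph G \<longleftrightarrow> (\<forall>e\<in>edges G. ends G e \<subseteq> verts G \<and> card (ends G e) = 2)"

text \<open>
  A path \<open>v\<^sub>0 e\<^sub>1 v\<^sub>1 \<dots> e\<^sub>n v\<^sub>n\<close> is stored as its list of vertices together with its list of
  edges. A path of length at least one thus has two representations (one for each direction);
  these share their edges, so at most one of them can belong to an edge-disjoint system.
\<close>

type_synonym ('v, 'e) path = "'v list \<times> 'e list"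

definition path_in :: "('v, 'e) multigraph \<Rightarrow> ('v, 'e) path \<Rightarrow> bool" where
  "path_in G = (\<lambda>(vs, es).
     length vs = Suc (length es) \<and> distinct vs \<and>
     set vs \<subseteq> verts G \<and> set es \<subseteq> edges G \<and>
     (\<forall>i<length es. ends G (es ! i) = {vs ! i, vs ! Suc i}))"

definition path_edges :: "('v, 'e) path \<Rightarrow> 'e set" where
  "path_edges p = set (snd p)"

definition endvertices :: "('v, 'e) path \<Rightarrow> 'v set" where
  "endvertices p = {hd (fst p), last (fst p)}"

definition connected_multigraph :: "('v, 'e) multigraph \<Rightarrow> bool" where
  "connected_multigraph G \<longleftrightarrow> wf_multigraph G \<and> verts G \<noteq> {} \<and>
     (\<forall>u\<in>verts G. \<forall>v\<in>verts G. \<exists>p. path_in G p \<and> endvertices p = {u, v})"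

definition is_join :: "('v, 'e) multigraph \<Rightarrow> 'v set \<Rightarrow> ('v, 'e) path set \<Rightarrow> bool" where
  "is_join G T P \<longleftrightarrow>
     (\<forall>p\<in>P. path_in G p) \<and>
     pairwise (\<lambda>p q. disjnt (path_edges p) (path_edges q)) P \<and>
     (\<forall>p\<in>P. endvertices p \<subseteq> T \<and> card (endvertices p) = 2) \<and>
     (\<forall>v\<in>T. \<exists>!p. p \<in> P \<and> v \<in> endvertices p)"

definition has_join :: "('v, 'e) multigraph \<Rightarrow> 'v set \<Rightarrow> bool" where
  "has_join G T \<longleftrightarrow> (\<exists>P. is_join G T P)"

definition property_A :: "('v, 'e) multigraph \<Rightarrow> 'v set \<Rightarrow> bool" where
  "property_A G T \<longleftrightarrow>
     (\<forall>T'\<subseteq>verts G. finite (sym_diff T T') \<longrightarrow> has_join G T')"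

definition property_B :: "('v, 'e) multigraph \<Rightarrow> 'v set \<Rightarrow> bool" where
  "property_B G T \<longleftrightarrow>
     (\<forall>T'\<subseteq>verts G. finite (sym_diff T T') \<longrightarrow>
        (even (card (sym_diff T T')) \<longrightarrow> has_join G T') \<and>
        (odd (card (sym_diff T T')) \<longrightarrow> \<not> has_join G T'))"

definition property_C :: "('v, 'e) multigraph \<Rightarrow> 'v set \<Rightarrow> bool" where
  "property_C G T \<longleftrightarrow>
     (\<forall>T'\<subseteq>verts G. finite (sym_diff T T') \<longrightarrow>
        (odd (card (sym_diff T T')) \<longrightarrow> has_join G T') \<and>
        (even (card (sym_diff T T')) \<longrightarrow> \<not> has_join G T'))"

end

theory Submission
  imports Defs
begin

text \<open>
  Rerouting along a path shows that having a join is invariant under changes of \<open>T\<close> by an even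
  number of vertices. So it remains to see that \<open>T\<close> or \<open>T \<triangle> {r}\<close> has a join, and for this it
  suffices to work in a breadth-first spanning tree with root \<open>r\<close>. There one has to choose the set
  \<open>F\<close> of vertices whose parent edge is used, such that at each vertex the number of used edges has
  the parity prescribed by \<open>T\<close> or is infinite; the used edges at each vertex are then paired up and
  the paths follow the pairings. To ensure that these paths are finite, from every vertex of \<open>F\<close> one
  must be able to descend along used edges to an element of \<open>T\<close>.

  Such an \<open>F\<close> is obtained from a maximal choice on a set of vertices closed under taking children
  (Zorn's lemma). Outside its domain, call a vertex deficient if it has an odd finite number of used
  edges from below (counting the vertex itself if it lies in \<open>T\<close>). By maximality every vertex outside
  the domain has deficient vertices properly below it, and one can proceed from the root downwards:
  a vertex with the wrong parity uses the edge to the child that leads to a nearest deficient vertex,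
  which is reached after finitely many steps.
\<close>

section \<open>Joins as families of linked pairs\<close>

definition adj :: "('v, 'e) multigraph \<Rightarrow> 'e set \<Rightarrow> 'v rel" where
  "adj G E = {(u, v). \<exists>e\<in>E. ends G e = {u, v}}"

lemma adj_mono: "E \<subseteq> E' \<Longrightarrow> adj G E \<subseteq> adj G E'"
  by (auto simp: adj_def)

lemma reach_mono: "(a, b) \<in> (adj G E)\<^sup>* \<Longrightarrow> E \<subseteq> E' \<Longrightarrow> (a, b) \<in> (adj G E')\<^sup>*"
  using rtrancl_mono[OF adj_mono] by blast

lemma sym_adj: "sym (adj G E)"
  by (auto simp: adj_def sym_def insert_commute)

lemma reach_sym: "(a, b) \<in> (adj G E)\<^sup>* \<Longrightarrow> (b, a) \<in> (adj G E)\<^sup>*"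
  by (rule symD[OF sym_rtrancl[OF sym_adj]])

text \<open>Induction along the chain: a path to the previous vertex is cut off at the new vertex if
  it already visits it, and is otherwise extended by the new edge.\<close>

lemma reach_path:
  assumes wf: "wf_multigraph G" and E: "E \<subseteq> edges G" and a: "a \<in> verts G"
    and reach: "(a, b) \<in> (adj G E)\<^sup>*"
  obtains vs es where "path_in G (vs, es)" "hd vs = a" "last vs = b" "set es \<subseteq> E"
proof -
  from reach have "\<exists>vs es. path_in G (vs, es) \<and> hd vs = a \<and> last vs = b \<and> set es \<subseteq> E"
  proof induction
    case base
    have "path_in G ([a], []) \<and> hd [a] = a \<and> last [a] = a \<and> set [] \<subseteq> E"
      using a by (simp add: path_in_def)
    then show ?case by blast
  next
    case (step y z)
    then obtain vs es where p: "path_in G (vs, es)" "hd vs = a" "last vs = y" "set es \<subseteq> E"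
      by blast
    from step.hyps obtain e where e: "e \<in> E" "ends G e = {y, z}"
      by (auto simp: adj_def)
    have ne: "vs \<noteq> []" and len: "length vs = Suc (length es)"
      using p(1) by (auto simp: path_in_def)
    show ?case
    proof (cases "z \<in> set vs")
      case True
      then obtain k where k: "k < length vs" "vs ! k = z"
        by (auto simp: in_set_conv_nth)
      let ?vs = "take (Suc k) vs" and ?es = "take k es"
      have "path_in G (?vs, ?es)"
        using p(1) k(1) by (auto simp: path_in_def dest: in_set_takeD)
      moreover have "last ?vs = z"
        using k by (simp add: take_Suc_conv_app_nth)
      moreover have "hd ?vs = a"
        using p(2) ne by simp
      moreover have "set ?es \<subseteq> E"
        using p(4) by (auto dest: in_set_takeD)
      ultimately show ?thesis by blast
    next
      case False
      have last: "vs ! length es = y"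
        using p(3) ne len by (simp add: last_conv_nth)
      have "z \<in> verts G"
        using wf E e by (auto simp: wf_multigraph_def)
      then have "path_in G (vs @ [z], es @ [e])"
        using p(1) False E e last len
        by (auto simp: path_in_def nth_append less_Suc_eq)
      then show ?thesis
        using p(2,4) ne e(1) by (intro exI[of _ "vs @ [z]"] exI[of _ "es @ [e]"]) auto
    qed
  qed
  then show thesis using that by blast
qed

lemma path_reach_nth:
  assumes p: "path_in G (vs, es)" and le: "i \<le> j" "j \<le> length es"
    and E: "\<And>k. i \<le> k \<Longrightarrow> k < j \<Longrightarrow> es ! k \<in> E"
  shows "(vs ! i, vs ! j) \<in> (adj G E)\<^sup>*"
  using le E
proof (induction j)
  case (Suc j)
  show ?case
  proof (cases "i = Suc j")
    case False
    then have "(vs ! i, vs ! j) \<in> (adj G E)\<^sup>*"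
      using Suc by simp
    moreover have "(vs ! j, vs ! Suc j) \<in> adj G E"
      using p Suc.prems False by (auto simp: path_in_def adj_def intro!: bexI[of _ "es ! j"])
    ultimately show ?thesis by (rule rtrancl_into_rtrancl)
  qed simp
qed simp

lemma path_hd_last:
  assumes "path_in G (vs, es)"
  shows "hd vs = vs ! 0" "last vs = vs ! length es"
proof -
  have len: "length vs = Suc (length es)"
    using assms by (simp add: path_in_def)
  then have "vs \<noteq> []" by auto
  then show "hd vs = vs ! 0" "last vs = vs ! length es"
    using len by (simp_all add: hd_conv_nth last_conv_nth)
qed

lemma path_reach:
  assumes "path_in G (vs, es)"
  shows "(hd vs, last vs) \<in> (adj G (set es))\<^sup>*"
  using path_reach_nth[OF assms, of 0 "length es" "set es"] path_hd_last[OF assms] by simp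

lemma path_distinct_edges:
  assumes "path_in G (vs, es)"
  shows "distinct es"
proof -
  have ends: "ends G (es ! k) = {vs ! k, vs ! Suc k}" if "k < length es" for k
    using assms that by (simp add: path_in_def)
  { fix i j assume ij: "i < j" "j < length es" "es ! i = es ! j"
    then have eq: "{vs ! i, vs ! Suc i} = {vs ! j, vs ! Suc j}"
      using ends[of i] ends[of j] by simp
    have "vs ! i \<noteq> vs ! j" "vs ! i \<noteq> vs ! Suc j"
      using assms ij(1,2) by (auto simp: path_in_def nth_eq_iff_index_eq)
    with eq have False by blast }
  then show ?thesis
    unfolding distinct_conv_nth by (metis linorder_neqE_nat)
qed

text \<open>Serves to reroute a path of a join along one of its own edges: removing \<open>e\<close>
  leaves two segments, which share no edge because a path repeats none.\<close>

lemma path_split: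
  assumes p: "path_in G (vs, es)" and e: "e \<in> set es"
  obtains u v E1 E2 where "ends G e = {u, v}" "E1 \<subseteq> set es" "E2 \<subseteq> set es"
    "e \<notin> E1" "e \<notin> E2" "E1 \<inter> E2 = {}"
    "(hd vs, u) \<in> (adj G E1)\<^sup>*" "(v, last vs) \<in> (adj G E2)\<^sup>*"
proof -
  obtain i where i: "i < length es" "es ! i = e"
    using e by (auto simp: in_set_conv_nth)
  let ?E1 = "set (take i es)" and ?E2 = "set (drop (Suc i) es)"
  have "distinct (take i es @ e # drop (Suc i) es)"
    using path_distinct_edges[OF p] i id_take_nth_drop[OF i(1)] by simp
  then have d: "e \<notin> ?E1" "e \<notin> ?E2" "?E1 \<inter> ?E2 = {}"
    by auto
  have "(hd vs, vs ! i) \<in> (adj G ?E1)\<^sup>*"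
  proof -
    have "es ! k \<in> ?E1" if "k < i" for k
      using that i by (auto simp: in_set_conv_nth intro!: exI[of _ k])
    then show ?thesis
      using path_reach_nth[OF p, of 0 i ?E1] i path_hd_last[OF p] by auto
  qed
  moreover have "(vs ! Suc i, last vs) \<in> (adj G ?E2)\<^sup>*"
  proof -
    have "es ! k \<in> ?E2" if "Suc i \<le> k" "k < length es" for k
      using that by (auto simp: in_set_conv_nth intro!: exI[of _ "k - Suc i"])
    then show ?thesis
      using path_reach_nth[OF p, of "Suc i" "length es" ?E2] i path_hd_last[OF p] by auto
  qed
  moreover have "ends G e = {vs ! i, vs ! Suc i}"
    using p i by (auto simp: path_in_def)
  ultimately show thesis
    using that d set_take_subset set_drop_subset by metis
qed

definition linked :: "('v, 'e) multigraph \<Rightarrow> 'v set \<Rightarrow> 'e set \<Rightarrow> bool" where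
  "linked G D E \<longleftrightarrow> card D = 2 \<and> D \<subseteq> verts G \<and> E \<subseteq> edges G \<and>
     (\<forall>a\<in>D. \<forall>b\<in>D. (a, b) \<in> (adj G E)\<^sup>*)"

text \<open>
  A join in which each path is replaced by the pair of its set of endvertices and some set of
  edges containing it. Rerouting then amounts to taking unions of edge sets, without having to
  shorten walks to paths.
\<close>

definition linkage :: "('v, 'e) multigraph \<Rightarrow> 'e set \<Rightarrow> 'v set \<Rightarrow> ('v set \<times> 'e set) set \<Rightarrow> bool" where
  "linkage G F T S \<longleftrightarrow> (\<forall>(D, E)\<in>S. linked G D E \<and> E \<subseteq> F) \<and>
     pairwise (\<lambda>(D, E) (D', E'). D \<inter> D' = {} \<and> E \<inter> E' = {}) S \<and> T = \<Union>(fst ` S)"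

lemma linkageD:
  assumes "linkage G F T S" "(D, E) \<in> S"
  shows "linked G D E" "E \<subseteq> F" "D \<subseteq> T"
  using assms unfolding linkage_def by (auto intro!: bexI[of _ "(D, E)"])

definition joinable :: "('v, 'e) multigraph \<Rightarrow> 'e set \<Rightarrow> 'v set \<Rightarrow> bool" where
  "joinable G F T \<longleftrightarrow> (\<exists>S. linkage G F T S)"

lemma joinable_subset: "joinable G F T \<Longrightarrow> T \<subseteq> verts G"
proof -
  assume "joinable G F T"
  then obtain S where S: "linkage G F T S" by (auto simp: joinable_def)
  have "fst s \<subseteq> verts G" if "s \<in> S" for s
    using linkageD(1)[OF S, of "fst s" "snd s"] that by (simp add: linked_def)
  moreover have "T = \<Union>(fst ` S)" using S by (simp add: linkage_def)
  ultimately show "T \<subseteq> verts G" by blast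
qed

lemma joinable_mono: "joinable G F T \<Longrightarrow> F \<subseteq> F' \<Longrightarrow> joinable G F' T"
  unfolding joinable_def linkage_def by (erule ex_forward) blast

lemma linked_pair:
  "linked G {a, b} E \<longleftrightarrow> a \<noteq> b \<and> a \<in> verts G \<and> b \<in> verts G \<and> E \<subseteq> edges G \<and> (a, b) \<in> (adj G E)\<^sup>*"
  by (auto simp: linked_def card_insert_if dest: reach_sym)

lemma linked_path:
  assumes "wf_multigraph G" and "linked G D E"
  obtains p where "path_in G p" "endvertices p = D" "path_edges p \<subseteq> E"
proof -
  obtain a b where D: "D = {a, b}" "a \<noteq> b"
    using assms(2) by (auto simp: linked_def card_2_iff)
  then obtain vs es where "path_in G (vs, es)" "hd vs = a" "last vs = b" "set es \<subseteq> E"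
    using reach_path[OF assms(1), of E a b] assms(2) by (auto simp: linked_pair)
  then show thesis
    using D that[of "(vs, es)"] by (auto simp: endvertices_def path_edges_def)
qed

lemma endvertices_subset: "path_in G p \<Longrightarrow> endvertices p \<subseteq> verts G"
proof (cases p)
  case (Pair vs es)
  assume "path_in G p"
  then have "vs \<noteq> []" "set vs \<subseteq> verts G"
    using Pair by (auto simp: path_in_def)
  then show "endvertices p \<subseteq> verts G"
    using Pair hd_in_set[of vs] last_in_set[of vs] by (auto simp: endvertices_def)
qed

lemma path_linked:
  assumes "path_in G p" "card (endvertices p) = 2"
  shows "linked G (endvertices p) (path_edges p)"
proof -
  obtain vs es where [simp]: "p = (vs, es)" by (cases p)
  have "hd vs \<noteq> last vs"
    using assms(2) by (auto simp: endvertices_def)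
  moreover have "set es \<subseteq> edges G"
    using assms(1) by (auto simp: path_in_def)
  ultimately show ?thesis
    using endvertices_subset[OF assms(1)] path_reach[of G vs es] assms(1)
    by (auto simp: endvertices_def path_edges_def linked_pair)
qed

text \<open>A path yields its pair of ends with its edges; conversely, a linked pair contains a
  path, and passing to smaller edge sets keeps disjointness.\<close>

lemma has_join_iff_joinable:
  assumes wf: "wf_multigraph G"
  shows "has_join G T \<longleftrightarrow> joinable G (edges G) T"
proof
  assume "has_join G T"
  then obtain P where P: "is_join G T P" by (auto simp: has_join_def)
  have l: "linked G (endvertices p) (path_edges p)" if "p \<in> P" for p
    using P that by (intro path_linked) (auto simp: is_join_def)
  have e: "endvertices p \<inter> endvertices q = {}" if "p \<in> P" "q \<in> P" "p \<noteq> q" for p q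
  proof (rule ccontr)
    assume "endvertices p \<inter> endvertices q \<noteq> {}"
    then obtain v where v: "v \<in> endvertices p" "v \<in> endvertices q" by blast
    then have "v \<in> T" using P that by (auto simp: is_join_def)
    then show False using P that v unfolding is_join_def by blast
  qed
  let ?S = "(\<lambda>p. (endvertices p, path_edges p)) ` P"
  have "linkage G (edges G) T ?S"
    unfolding linkage_def
  proof (intro conjI)
    show "\<forall>(D, E)\<in>?S. linked G D E \<and> E \<subseteq> edges G"
      using l by (auto simp: linked_def)
    show "pairwise (\<lambda>(D, E) (D', E'). D \<inter> D' = {} \<and> E \<inter> E' = {}) ?S"
    proof -
      have "endvertices p \<inter> endvertices q = {} \<and> path_edges p \<inter> path_edges q = {}"
        if "p \<in> P" "q \<in> P" "p \<noteq> q" for p q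
        using e[OF that] P that unfolding is_join_def pairwise_def disjnt_def by blast
      then show ?thesis
        unfolding pairwise_def by (smt (verit) case_prod_conv imageE)
    qed
    show "T = \<Union> (fst ` ?S)"
      using P unfolding is_join_def image_image fst_conv by blast
  qed
  then show "joinable G (edges G) T" by (auto simp: joinable_def)
next
  assume "joinable G (edges G) T"
  then obtain S where S: "linkage G (edges G) T S" by (auto simp: joinable_def)
  have "\<forall>s\<in>S. \<exists>p. path_in G p \<and> endvertices p = fst s \<and> path_edges p \<subseteq> snd s"
  proof
    fix s assume "s \<in> S"
    then have "linked G (fst s) (snd s)" using S by (auto simp: linkage_def)
    then show "\<exists>p. path_in G p \<and> endvertices p = fst s \<and> path_edges p \<subseteq> snd s"
      using linked_path[OF wf] by metis
  qed
  then obtain f where f: "\<And>s. s \<in> S \<Longrightarrow> path_in G (f s) \<and> endvertices (f s) = fst s \<and> path_edges (f s) \<subseteq> snd s"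
    by metis
  have disj: "fst s \<inter> fst s' = {} \<and> snd s \<inter> snd s' = {}" if "s \<in> S" "s' \<in> S" "s \<noteq> s'" for s s'
    using S that unfolding linkage_def pairwise_def by (auto simp: case_prod_beta)
  have T: "T = \<Union>(fst ` S)" and card: "\<And>s. s \<in> S \<Longrightarrow> card (fst s) = 2"
    using S by (auto simp: linkage_def linked_def)
  have "is_join G T (f ` S)"
    unfolding is_join_def
  proof (intro conjI)
    show "pairwise (\<lambda>p q. disjnt (path_edges p) (path_edges q)) (f ` S)"
      unfolding pairwise_def disjnt_def using f disj by blast
    show "\<forall>v\<in>T. \<exists>!p. p \<in> f ` S \<and> v \<in> endvertices p"
    proof
      fix v assume "v \<in> T"
      then obtain s where s: "s \<in> S" "v \<in> fst s" using T by blast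
      show "\<exists>!p. p \<in> f ` S \<and> v \<in> endvertices p"
        using s f disj by (intro ex1I[of _ "f s"]) blast+
    qed
  qed (use f card T in auto)
  then show "has_join G T" by (auto simp: has_join_def)
qed

section \<open>Rerouting: changing the set of ends by two vertices\<close>

lemma joinable_remove:
  assumes "linkage G F T S" "(D, E) \<in> S"
  shows "joinable G (F - E) (T - D)"
proof -
  have disj: "D \<inter> D' = {} \<and> E \<inter> E' = {}" if "(D', E') \<in> S" "(D', E') \<noteq> (D, E)" for D' E'
    using assms that by (fastforce simp: linkage_def pairwise_def)
  have "linkage G (F - E) (T - D) (S - {(D, E)})"
    unfolding linkage_def
  proof (intro conjI)
    show "\<forall>(D', E')\<in>S - {(D, E)}. linked G D' E' \<and> E' \<subseteq> F - E"
      using assms(1) disj by (fastforce simp: linkage_def)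
    show "pairwise (\<lambda>(D, E) (D', E'). D \<inter> D' = {} \<and> E \<inter> E' = {}) (S - {(D, E)})"
      using assms(1) unfolding linkage_def by (auto intro: pairwise_subset)
    show "T - D = \<Union> (fst ` (S - {(D, E)}))"
    proof -
      have "T = \<Union>(fst ` S)" using assms(1) by (simp add: linkage_def)
      also have "fst ` S = insert D (fst ` (S - {(D, E)}))" using assms(2) by force
      finally have "T = D \<union> \<Union>(fst ` (S - {(D, E)}))" by simp
      moreover have "D \<inter> \<Union>(fst ` (S - {(D, E)})) = {}"
        using disj by (auto simp: disjoint_iff) metis+
      ultimately show ?thesis by blast
    qed
  qed
  then show ?thesis by (auto simp: joinable_def)
qed

lemma joinable_add:
  assumes "joinable G F T" "linked G D E" "D \<inter> T = {}" "E \<inter> F = {}"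
  shows "joinable G (F \<union> E) (T \<union> D)"
proof -
  obtain S where S: "linkage G F T S" using assms(1) by (auto simp: joinable_def)
  have disj: "D \<inter> D' = {} \<and> E \<inter> E' = {}" if "(D', E') \<in> S" for D' E'
    using S that assms(3,4) by (fastforce simp: linkage_def)
  have "linkage G (F \<union> E) (T \<union> D) (insert (D, E) S)"
    unfolding linkage_def
  proof (intro conjI)
    show "\<forall>(D', E')\<in>insert (D, E) S. linked G D' E' \<and> E' \<subseteq> F \<union> E"
      using S assms(2) by (auto simp: linkage_def)
    show "pairwise (\<lambda>(D, E) (D', E'). D \<inter> D' = {} \<and> E \<inter> E' = {}) (insert (D, E) S)"
      using S disj by (auto simp: linkage_def pairwise_insert)
    show "T \<union> D = \<Union> (fst ` insert (D, E) S)"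
      using S by (auto simp: linkage_def)
  qed
  then show ?thesis by (auto simp: joinable_def)
qed

lemma joinable_remove_vertex:
  assumes "joinable G F T" "u \<in> T"
  obtains u' E where "u' \<in> T" "u' \<noteq> u" "E \<subseteq> F" "linked G {u, u'} E" "joinable G (F - E) (T - {u, u'})"
proof -
  obtain S where S: "linkage G F T S" using assms(1) by (auto simp: joinable_def)
  then obtain D E where DE: "(D, E) \<in> S" "u \<in> D"
    using assms(2) by (auto simp: linkage_def)
  note l = linkageD[OF S DE(1)]
  from l(1) obtain u' where "D = {u, u'}" "u' \<noteq> u"
    using DE(2) by (auto simp: linked_def card_2_iff)
  then show thesis
    using that[of u' E] l joinable_remove[OF S DE(1)] by auto
qed

text \<open>\<open>E\<close> consists of free edges. Distinct \<open>u\<close> and \<open>v\<close>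
  outside \<open>T\<close> become a new pair; if only one lies in \<open>T\<close>, its partner is
  linked to the other; if both do, their common pair is dropped or their partners are linked to each
  other.\<close>

lemma joinable_toggle:
  assumes J: "joinable G F T" and reach: "(u, v) \<in> (adj G E)\<^sup>*"
    and E: "E \<subseteq> edges G" "E \<inter> F = {}" and uv: "u \<in> verts G" "v \<in> verts G"
  shows "joinable G (F \<union> E) (sym_diff T (sym_diff {u} {v}))"
proof -
  \<comment> \<open>Stated for fresh \<open>u\<close> and \<open>v\<close>, since both orientations
    occur below.\<close>
  have one: "joinable G (F \<union> E) (sym_diff T (sym_diff {u} {v}))"
    if u: "u \<in> T" and v: "v \<notin> T" and reach: "(u, v) \<in> (adj G E)\<^sup>*" and vV: "v \<in> verts G" for u v
  proof -
    obtain u' E' where r: "u' \<in> T" "u' \<noteq> u" "E' \<subseteq> F" "linked G {u, u'} E'"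
      "joinable G (F - E') (T - {u, u'})"
      using joinable_remove_vertex[OF J u] .
    have "(u', u) \<in> (adj G (E' \<union> E))\<^sup>*" "(u, v) \<in> (adj G (E' \<union> E))\<^sup>*"
      using r(4) reach by (auto simp: linked_pair intro: reach_mono reach_sym)
    then have "linked G {u', v} (E' \<union> E)"
      using r(1,4) v vV E by (auto simp: linked_pair)
    then have "joinable G (F - E' \<union> (E' \<union> E)) (T - {u, u'} \<union> {u', v})"
      using r(5) E(2) r(3) v by (intro joinable_add) auto
    moreover have "T - {u, u'} \<union> {u', v} = sym_diff T (sym_diff {u} {v})"
      using u v r(1,2) by auto
    moreover have "F - E' \<union> (E' \<union> E) = F \<union> E"
      using r(3) by auto
    ultimately show ?thesis by simp
  qed
  consider "u = v" | "u \<noteq> v" "u \<notin> T" "v \<notin> T" | "u \<in> T" "v \<notin> T" | "u \<notin> T" "v \<in> T"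
    | "u \<noteq> v" "u \<in> T" "v \<in> T" by blast
  then show ?thesis
  proof cases
    case 1
    then show ?thesis using joinable_mono[OF J] by simp
  next
    case 2
    then have "joinable G (F \<union> E) (T \<union> {u, v})"
      using J E uv reach by (intro joinable_add) (auto simp: linked_pair)
    moreover have "T \<union> {u, v} = sym_diff T (sym_diff {u} {v})" using 2 by auto
    ultimately show ?thesis by simp
  next
    case 3
    then show ?thesis using one reach uv by simp
  next
    case 4
    then show ?thesis using one[of v u] reach_sym[OF reach] uv by (simp add: Un_commute)
  next
    case 5
    obtain u' E' where r: "u' \<in> T" "u' \<noteq> u" "E' \<subseteq> F" "linked G {u, u'} E'"
      "joinable G (F - E') (T - {u, u'})"
      using joinable_remove_vertex[OF J 5(2)] .
    show ?thesis
    proof (cases "v = u'")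
      case True
      then have "T - {u, u'} = sym_diff T (sym_diff {u} {v})" using 5 by auto
      with r(5) show ?thesis by (auto intro: joinable_mono)
    next
      case False
      then have "v \<in> T - {u, u'}" using 5 by simp
      from joinable_remove_vertex[OF r(5) this] obtain v' E'' where
        q: "v' \<in> T - {u, u'}" "v' \<noteq> v" "E'' \<subseteq> F - E'" "linked G {v, v'} E''"
        "joinable G (F - E' - E'') (T - {u, u'} - {v, v'})" .
      let ?E = "E' \<union> E \<union> E''"
      have "(u', u) \<in> (adj G ?E)\<^sup>*" "(u, v) \<in> (adj G ?E)\<^sup>*" "(v, v') \<in> (adj G ?E)\<^sup>*"
        using r(4) q(4) reach by (auto simp: linked_pair intro: reach_mono reach_sym)
      then have "(u', v') \<in> (adj G ?E)\<^sup>*" by (meson rtrancl_trans)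
      then have "linked G {u', v'} ?E"
        using r(4) q(1,4) E by (auto simp: linked_pair)
      then have "joinable G (F - E' - E'' \<union> ?E) (T - {u, u'} - {v, v'} \<union> {u', v'})"
        using q(5) E(2) r(3) q(3) by (intro joinable_add) auto
      moreover have "T - {u, u'} - {v, v'} \<union> {u', v'} = sym_diff T (sym_diff {u} {v})"
        using 5 r(1,2) q(1,2) False by auto
      moreover have "F - E' - E'' \<union> ?E = F \<union> E"
        using r(3) q(3) by auto
      ultimately show ?thesis by simp
    qed
  qed
qed

text \<open>If no pair uses \<open>e\<close>, it serves as the free edge set. Otherwise the pair
  using it is thinned out to a path: either this frees \<open>e\<close>, or the two segments of the
  path beside \<open>e\<close> are used for rerouting.\<close>

lemma joinable_toggle_edge:
  assumes wf: "wf_multigraph G" and J: "joinable G (edges G) T"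
    and e: "e \<in> edges G" "ends G e = {u, v}"
  shows "joinable G (edges G) (sym_diff T (sym_diff {u} {v}))"
proof -
  have uv: "u \<in> verts G" "v \<in> verts G"
    using wf e by (auto simp: wf_multigraph_def)
  have reach: "(u, v) \<in> (adj G {e})\<^sup>*"
    using e(2) by (auto simp: adj_def)
  have unused: ?thesis if "joinable G (edges G - {e}) T"
    using joinable_toggle[OF that reach] e(1) uv by (simp add: insert_absorb)
  obtain S where S: "linkage G (edges G) T S"
    using J by (auto simp: joinable_def)
  show ?thesis
  proof (cases "e \<in> \<Union>(snd ` S)")
    case False
    then have "\<forall>(D, E)\<in>S. e \<notin> E" by auto
    then have "linkage G (edges G - {e}) T S"
      using S unfolding linkage_def by blast
    then show ?thesis using unused by (auto simp: joinable_def)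
  next
    case True
    then obtain D E where DE: "(D, E) \<in> S" "e \<in> E" by auto
    note l = linkageD[OF S DE(1)]
    from l(1) obtain a b where D: "D = {a, b}" "a \<noteq> b"
      by (auto simp: linked_def card_2_iff)
    have ab: "a \<in> verts G" "b \<in> verts G" "(a, b) \<in> (adj G E)\<^sup>*"
      using l D by (auto simp: linked_pair)
    obtain vs es where p: "path_in G (vs, es)" "hd vs = a" "last vs = b" "set es \<subseteq> E"
      using reach_path[OF wf l(2) ab(1,3)] .
    have J': "joinable G (edges G - E) (T - {a, b})"
      using joinable_remove[OF S DE(1)] D by simp
    show ?thesis
    proof (cases "e \<in> set es")
      case False
      have "joinable G (edges G - E \<union> set es) (sym_diff (T - {a, b}) (sym_diff {a} {b}))"
        using J' path_reach[OF p(1)] p ab l(2) by (intro joinable_toggle) auto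
      moreover have "sym_diff (T - {a, b}) (sym_diff {a} {b}) = T"
        using l(3) D by auto
      ultimately have "joinable G (edges G - {e}) T"
        using False p(4) l(2) DE(2) by (auto elim!: joinable_mono)
      then show ?thesis by (rule unused)
    next
      case True
      obtain u' v' E1 E2 where s: "ends G e = {u', v'}" "E1 \<subseteq> set es" "E2 \<subseteq> set es"
        "E1 \<inter> E2 = {}" "(a, u') \<in> (adj G E1)\<^sup>*" "(v', b) \<in> (adj G E2)\<^sup>*"
        using path_split[OF p(1) True] p(2,3) by metis
      have uv': "u' \<in> verts G" "v' \<in> verts G" using uv e(2) s(1) by (auto simp: doubleton_eq_iff)
      have eq1: "sym_diff {u'} {v'} = sym_diff {u} {v}"
        using e(2) s(1) by (auto simp: doubleton_eq_iff)
      \<comment> \<open>Dropping the pair takes \<open>a\<close> and \<open>b\<close> out of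
        \<open>T\<close>; toggling along the two segments restores them and toggles the ends of
        \<open>e\<close> instead.\<close>
      have eq: "sym_diff (sym_diff (T - {a, b}) (sym_diff {a} {u'})) (sym_diff {v'} {b})
          = sym_diff T (sym_diff {u} {v})"
        unfolding eq1[symmetric] using l(3) D by auto
      have E12: "E1 \<subseteq> E" "E2 \<subseteq> E" "E1 \<subseteq> edges G" "E2 \<subseteq> edges G" using s(2,3) p(4) l(2) by auto
      have "joinable G (edges G - E \<union> E1) (sym_diff (T - {a, b}) (sym_diff {a} {u'}))"
        by (rule joinable_toggle[OF J' s(5)]) (use E12 ab uv' in auto)
      from joinable_toggle[OF this s(6)] have "joinable G (edges G - E \<union> E1 \<union> E2)
          (sym_diff (sym_diff (T - {a, b}) (sym_diff {a} {u'})) (sym_diff {v'} {b}))"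
        using E12 s(4) ab uv' by blast
      then have "joinable G (edges G - E \<union> E1 \<union> E2) (sym_diff T (sym_diff {u} {v}))"
        unfolding eq .
      then show ?thesis
        by (rule joinable_mono) (use E12 in auto)
    qed
  qed
qed

lemma connected_reach:
  assumes "connected_multigraph G" "u \<in> verts G" "v \<in> verts G"
  shows "(u, v) \<in> (adj G (edges G))\<^sup>*"
proof -
  obtain vs es where p: "path_in G (vs, es)" "endvertices (vs, es) = {u, v}"
    using assms by (fastforce simp: connected_multigraph_def)
  then have "(hd vs, last vs) \<in> (adj G (edges G))\<^sup>*"
    by (intro reach_mono[OF path_reach]) (auto simp: path_in_def)
  then show ?thesis
    using p(2) by (auto simp: endvertices_def doubleton_eq_iff dest: reach_sym)
qed

text \<open>Toggling along the edges of a walk telescopes, as intermediate vertices cancel.\<close>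

lemma joinable_toggle_pair:
  assumes G: "connected_multigraph G" and J: "joinable G (edges G) T"
    and uv: "u \<in> verts G" "v \<in> verts G"
  shows "joinable G (edges G) (sym_diff T (sym_diff {u} {v}))"
  using connected_reach[OF G uv]
proof induction
  case base
  then show ?case using J by simp
next
  case (step y z)
  then obtain e where e: "e \<in> edges G" "ends G e = {y, z}" by (auto simp: adj_def)
  have "wf_multigraph G" using G by (simp add: connected_multigraph_def)
  note joinable_toggle_edge[OF this step.IH e]
  moreover have "sym_diff (sym_diff T (sym_diff {u} {y})) (sym_diff {y} {z}) = sym_diff T (sym_diff {u} {z})"
    by auto
  ultimately show ?case by simp
qed

text \<open>Toggling two vertices of the symmetric difference shrinks it by two, so induction on its
  size, with \<open>T\<close> varying, reaches \<open>T'\<close>.\<close>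

lemma has_join_even_change:
  assumes G: "connected_multigraph G" and J: "has_join G T" and T': "T' \<subseteq> verts G"
    and fin: "finite (sym_diff T T')" and ev: "even (card (sym_diff T T'))"
  shows "has_join G T'"
proof -
  have wf: "wf_multigraph G" using G by (simp add: connected_multigraph_def)
  have "joinable G (edges G) T \<Longrightarrow> finite (sym_diff T T') \<Longrightarrow> even (card (sym_diff T T'))
      \<Longrightarrow> joinable G (edges G) T'"
  proof (induction "card (sym_diff T T')" arbitrary: T rule: less_induct)
    case less
    show ?case
    proof (cases "sym_diff T T' = {}")
      case True
      then have "T = T'" by auto
      then show ?thesis using less.prems by simp
    next
      case False
      then obtain u where u: "u \<in> sym_diff T T'" by blast
      have "sym_diff T T' \<noteq> {u}" using less.prems(3) by auto
      then obtain v where v: "v \<in> sym_diff T T'" "v \<noteq> u" using u by blast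
      let ?U = "sym_diff T (sym_diff {u} {v})"
      have eq: "sym_diff ?U T' = sym_diff T T' - {u, v}" using u v by auto
      have "sym_diff T T' = insert u (insert v (sym_diff ?U T'))" using u v by auto
      then have card: "card (sym_diff T T') = card (sym_diff ?U T') + 2"
        using v(2) less.prems(2)
        by (metis (no_types, lifting) DiffD2 add_2_eq_Suc' card_insert_disjoint eq finite_Diff insertCI
            finite_insert insertE)
      have "u \<in> verts G" "v \<in> verts G"
        using u v T' joinable_subset[OF less.prems(1)] by auto
      then have "joinable G (edges G) ?U"
        using joinable_toggle_pair[OF G less.prems(1)] by simp
      moreover have "finite (sym_diff ?U T')" using less.prems(2) unfolding eq by simp
      ultimately show ?thesis using less.hyps[of ?U] card less.prems(3) by simp
    qed
  qed
  then show ?thesis using J fin ev has_join_iff_joinable[OF wf] by simp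
qed

lemma joinable_family:
  assumes "\<And>i. i \<in> I \<Longrightarrow> linked G (D i) (E i) \<and> E i \<subseteq> F"
    and "\<And>i j. i \<in> I \<Longrightarrow> j \<in> I \<Longrightarrow> i \<noteq> j \<Longrightarrow> D i \<inter> D j = {} \<and> E i \<inter> E j = {}"
  shows "joinable G F (\<Union>i\<in>I. D i)"
proof -
  let ?S = "(\<lambda>i. (D i, E i)) ` I"
  have "pairwise (\<lambda>(D, E) (D', E'). D \<inter> D' = {} \<and> E \<inter> E' = {}) ?S"
    unfolding pairwise_def using assms(2) by (auto simp: disjoint_iff)
  then have "linkage G F (\<Union>i\<in>I. D i) ?S"
    using assms(1) by (auto simp: linkage_def)
  then show ?thesis by (auto simp: joinable_def)
qed

section \<open>Parity-correct edge choices in rooted trees\<close>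

text \<open>The tree is given by its parent map, without a graph. That \<open>d\<close> drops
  towards the root permits recursion from the root downwards and induction along ancestors.\<close>

locale rooted_tree =
  fixes V :: "'v set" and r :: 'v and p :: "'v \<Rightarrow> 'v" and d :: "'v \<Rightarrow> nat"
  assumes root: "r \<in> V"
    and parent: "x \<in> V \<Longrightarrow> x \<noteq> r \<Longrightarrow> p x \<in> V \<and> d (p x) < d x"
begin

definition children :: "'v \<Rightarrow> 'v set" where
  "children x = {c \<in> V. c \<noteq> r \<and> p c = x}"

text \<open>
  \<open>F\<close> is the set of vertices whose parent edge is used. The tokens at \<open>x\<close> represent the used edges
  from below and, as \<open>x\<close> itself, the end of a path at \<open>x \<in> T\<close>.
\<close>

definition tokens :: "'v set \<Rightarrow> 'v set \<Rightarrow> 'v \<Rightarrow> 'v set" where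
  "tokens T F x = children x \<inter> F \<union> {x} \<inter> T"

text \<open>Certifies a finite descent along used edges to an element of \<open>T\<close>; the
  number of steps is recorded so that shortest descents can be chosen later.\<close>

inductive grounded :: "'v set \<Rightarrow> 'v set \<Rightarrow> nat \<Rightarrow> 'v \<Rightarrow> bool" for T F where
  base: "x \<in> F \<Longrightarrow> x \<in> T \<Longrightarrow> grounded T F 0 x"
| step: "x \<in> F \<Longrightarrow> c \<in> children x \<Longrightarrow> grounded T F n c \<Longrightarrow> grounded T F (Suc n) x"

text \<open>The parent edge is to be used exactly when finitely many tokens cannot be paired among
  themselves; infinitely many can be paired with or without one of them.\<close>

definition balanced :: "'v set \<Rightarrow> 'v set \<Rightarrow> 'v \<Rightarrow> bool" where
  "balanced T F x \<longleftrightarrow> (finite (tokens T F x) \<longrightarrow> (odd (card (tokens T F x)) \<longleftrightarrow> x \<in> F))"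

lemma grounded_mono: "grounded T F n x \<Longrightarrow> F \<subseteq> F' \<Longrightarrow> grounded T F' n x"
  by (induction rule: grounded.induct) (auto intro: grounded.intros)

lemma grounded_in: "grounded T F n x \<Longrightarrow> x \<in> F"
  by (auto elim: grounded.cases)

lemma grounded_token:
  assumes "x \<in> F" "tokens T F x \<noteq> {}" "\<And>c. c \<in> children x \<inter> F \<Longrightarrow> \<exists>n. grounded T F n c"
  shows "\<exists>n. grounded T F n x"
  using assms unfolding tokens_def by (auto intro: grounded.intros)

lemma children_not_self: "x \<notin> children x"
  using parent[of x] by (auto simp: children_def)

text \<open>Well-founded recursion on \<open>d\<close>: values pass from parents to children,
  starting with \<open>False\<close> at the root, which has no parent edge.\<close>

lemma parent_recursion:
  obtains h :: "'v \<Rightarrow> bool" where "\<not> h r" "\<And>x. x \<in> V \<Longrightarrow> x \<noteq> r \<Longrightarrow> h x = \<phi> x (h (p x))"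
proof -
  define H where "H = (\<lambda>f x. if x \<in> V \<and> x \<noteq> r then \<phi> x (f (p x)) else False)"
  define h where "h = wfrec (measure d) H"
  have "h x = H h x" for x
  proof -
    have "h x = H (cut h (measure d) x) x"
      unfolding h_def by (rule wfrec[OF wf_measure])
    also have "\<dots> = H h x"
      using parent[of x] by (simp add: H_def cut_apply)
    finally show ?thesis .
  qed
  then show thesis
    using that[of h] by (simp add: H_def)
qed

text \<open>
  A partial choice of used parent edges is encoded by its graph \<open>M\<close>: \<open>(x, True) \<in> M\<close> means that
  the parent edge of \<open>x\<close> is used, \<open>(x, False) \<in> M\<close> that it is not.
\<close>

definition used :: "('v \<times> bool) set \<Rightarrow> 'v set" where
  "used M = {x. (x, True) \<in> M}"

text \<open>Closure under children fixes the tokens at every decided vertex, so a consistent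
  extension of \<open>M\<close> cannot spoil the balance there. Inclusion is extension of choices,
  the order for Zorn's lemma.\<close>

definition admissible :: "'v set \<Rightarrow> ('v \<times> bool) set \<Rightarrow> bool" where
  "admissible T M \<longleftrightarrow> (\<forall>(x, b)\<in>M. x \<in> V \<and> (x, \<not> b) \<notin> M \<and> children x \<subseteq> Domain M \<and>
     balanced T (used M) x \<and> (b \<longrightarrow> (\<exists>n. grounded T (used M) n x)))"

lemma used_mono: "M \<subseteq> M' \<Longrightarrow> used M \<subseteq> used M'"
  by (auto simp: used_def)

lemma admissibleD:
  assumes "admissible T M" "(x, b) \<in> M"
  shows "x \<in> V" "(x, \<not> b) \<notin> M" "children x \<subseteq> Domain M" "balanced T (used M) x"
    "b \<Longrightarrow> \<exists>n. grounded T (used M) n x"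
  using assms by (auto simp: admissible_def)

lemma tokens_extend:
  assumes "M \<subseteq> M'" "children x \<subseteq> Domain M" "\<And>c b. (c, b) \<in> M \<Longrightarrow> (c, \<not> b) \<notin> M'"
  shows "tokens T (used M') x = tokens T (used M) x"
proof -
  have "c \<in> used M' \<longleftrightarrow> c \<in> used M" if c: "c \<in> children x" for c
  proof -
    obtain b where "(c, b) \<in> M" using assms(2) c by auto
    then show ?thesis using assms(1) assms(3)[of c b] by (cases b) (auto simp: used_def)
  qed
  then show ?thesis by (auto simp: tokens_def)
qed

text \<open>Serves all extensions below: unions of chains and the two that contradict
  maximality.\<close>

lemma admissible_extend:
  assumes M: "admissible T M" "(x, b) \<in> M" and M': "M \<subseteq> M'"
    and cons: "\<And>c b. (c, b) \<in> M \<Longrightarrow> (c, \<not> b) \<notin> M'"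
  shows "x \<in> V \<and> (x, \<not> b) \<notin> M' \<and> children x \<subseteq> Domain M' \<and>
     balanced T (used M') x \<and> (b \<longrightarrow> (\<exists>n. grounded T (used M') n x))"
proof -
  note D = admissibleD[OF M]
  have "x \<in> used M' \<longleftrightarrow> x \<in> used M"
    using cons[OF M(2)] M' M(2) by (cases b) (auto simp: used_def)
  then have "balanced T (used M') x"
    using D(4) tokens_extend[OF M' D(3) cons] by (simp add: balanced_def)
  moreover have "\<exists>n. grounded T (used M') n x" if b
    using D(5)[OF that] grounded_mono used_mono[OF M'] by blast
  moreover have "children x \<subseteq> Domain M'" using D(3) M' by auto
  ultimately show ?thesis using D(1) cons[OF M(2)] by blast
qed

text \<open>Contradictory values from two members of the chain would both occur in the larger one;
  the rest is \<open>admissible_extend\<close>.\<close>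

lemma admissible_Union:
  assumes C: "subset.chain {M. admissible T M} C"
  shows "admissible T (\<Union>C)"
proof -
  have adm: "admissible T M" if "M \<in> C" for M
    using C that by (auto simp: subset.chain_def)
  have cons: "(c, \<not> b) \<notin> \<Union>C" if "(c, b) \<in> M" "M \<in> C" for c b M
  proof
    assume "(c, \<not> b) \<in> \<Union>C"
    then obtain N where N: "N \<in> C" "(c, \<not> b) \<in> N" by blast
    have "M \<subseteq> N \<or> N \<subseteq> M"
      using C N(1) that(2) unfolding subset.chain_def by blast
    then show False
      using admissibleD(2)[OF adm[OF N(1)] N(2)] admissibleD(2)[OF adm[OF that(2)] that(1)] N(2) that(1)
      by auto
  qed
  show ?thesis
    unfolding admissible_def
  proof clarify
    fix x b M assume "(x, b) \<in> M" "M \<in> C"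
    then show "x \<in> V \<and> (x, \<not> b) \<notin> \<Union>C \<and> children x \<subseteq> Domain (\<Union>C) \<and>
        balanced T (used (\<Union>C)) x \<and> (b \<longrightarrow> (\<exists>n. grounded T (used (\<Union>C)) n x))"
      using admissible_extend[OF adm, of M x b "\<Union>C"] cons by blast
  qed
qed

lemma balanced_choice_exists:
  obtains F where "F \<subseteq> V" "\<And>x. x \<in> V \<Longrightarrow> balanced T F x" "\<And>x. x \<in> F \<Longrightarrow> \<exists>n. grounded T F n x"
proof -
  obtain M where adm: "admissible T M" and max: "\<And>M'. admissible T M' \<Longrightarrow> M \<subseteq> M' \<Longrightarrow> M' = M"
    using subset_Zorn'[of "{M. admissible T M}"] admissible_Union by auto
  let ?A = "Domain M" and ?F = "used M"
  \<comment> \<open>\<open>B\<close> holds the undecided vertices, and \<open>Q\<close> those among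
    them that would be unbalanced if no further parent edge were used.\<close>
  define B where "B = V - ?A"
  define Q where "Q = {x \<in> B. finite (tokens T ?F x) \<and> odd (card (tokens T ?F x))}"
  define ch where "ch = {(x, c). c \<in> children x \<and> c \<in> B}"
  have AV: "?A \<subseteq> V" using admissibleD(1)[OF adm] by auto
  have FA: "?F \<subseteq> ?A" by (auto simp: used_def)
  have desc_B: "y \<in> B" if "(x, y) \<in> ch\<^sup>*" "x \<in> B" for x y
    using that by (induction) (auto simp: ch_def)

  \<comment> \<open>Otherwise \<open>x\<close> and all its descendants in \<open>B\<close> could be
    decided with \<open>False\<close>, since their tokens from \<open>M\<close> are already
    balanced.\<close>
  have reaches_Q: "\<exists>q\<in>Q. (x, q) \<in> ch\<^sup>*" if x: "x \<in> B" for x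
  proof (rule ccontr)
    assume noQ: "\<not> ?thesis"
    define D where "D = {y. (x, y) \<in> ch\<^sup>*}"
    let ?M = "M \<union> D \<times> {False}"
    have DB: "D \<subseteq> B" using desc_B x by (auto simp: D_def)
    have F: "used ?M = ?F" by (auto simp: used_def)
    have cons: "(c, \<not> b) \<notin> ?M" if "(c, b) \<in> M" for c b
      using admissibleD(2)[OF adm that] that DB by (auto simp: B_def)
    have "admissible T ?M"
      unfolding admissible_def
    proof clarify
      fix y b assume yb: "(y, b) \<in> ?M"
      show "y \<in> V \<and> (y, \<not> b) \<notin> ?M \<and> children y \<subseteq> Domain ?M \<and>
          balanced T (used ?M) y \<and> (b \<longrightarrow> (\<exists>n. grounded T (used ?M) n y))"
      proof (cases "(y, b) \<in> M")
        case True
        then show ?thesis using admissible_extend[OF adm True _ cons] by blast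
      next
        case False
        then have y: "y \<in> D" "\<not> b" using yb by auto
        then have yB: "y \<in> V" "y \<notin> ?A" "y \<notin> ?F" using DB FA by (auto simp: B_def)
        have "c \<in> D" if "c \<in> children y" "c \<in> B" for c
          using y(1) that by (auto simp: D_def ch_def intro: rtrancl_into_rtrancl)
        then have "children y \<subseteq> Domain ?M" by (auto simp: children_def B_def)
        moreover have "y \<notin> Q" using noQ y(1) by (auto simp: D_def)
        then have "balanced T ?F y"
          using yB y(1) DB by (auto simp: Q_def balanced_def)
        ultimately show ?thesis using y(2) yB F by auto
      qed
    qed
    then have "?M = M" using max by blast
    moreover have "x \<in> D" by (simp add: D_def)
    ultimately show False using x by (auto simp: B_def)
  qed

  \<comment> \<open>If all children of \<open>x\<close> were decided, \<open>x\<close> itself would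
    be in \<open>Q\<close> by \<open>reaches_Q\<close>. It could then be decided with
    \<open>True\<close>: an odd number of tokens balances it, and any one of them grounds
    it.\<close>
  have B_child: "\<exists>c. (x, c) \<in> ch" if x: "x \<in> B" for x
  proof (rule ccontr)
    assume no: "\<not> ?thesis"
    then have ch: "children x \<subseteq> ?A" by (auto simp: ch_def B_def children_def)
    have xV: "x \<in> V" "x \<notin> ?A" using x by (auto simp: B_def)
    have xQ: "x \<in> Q"
    proof -
      obtain q where q: "q \<in> Q" "(x, q) \<in> ch\<^sup>*" using reaches_Q[OF x] by blast
      from q(2) no have "q = x" by (cases rule: converse_rtranclE) auto
      with q(1) show ?thesis by simp
    qed
    let ?M = "insert (x, True) M"
    have cons: "(c, \<not> b) \<notin> ?M" if "(c, b) \<in> M" for c b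
      using admissibleD(2)[OF adm that] that xV by auto
    have tok: "tokens T (used ?M) x = tokens T ?F x"
      by (rule tokens_extend[OF _ ch cons]) auto
    have "admissible T ?M"
      unfolding admissible_def
    proof clarify
      fix y b assume yb: "(y, b) \<in> ?M"
      show "y \<in> V \<and> (y, \<not> b) \<notin> ?M \<and> children y \<subseteq> Domain ?M \<and>
          balanced T (used ?M) y \<and> (b \<longrightarrow> (\<exists>n. grounded T (used ?M) n y))"
      proof (cases "(y, b) \<in> M")
        case True
        then show ?thesis using admissible_extend[OF adm True _ cons] by blast
      next
        case False
        then have y: "y = x" "b" using yb by auto
        have xF: "x \<in> used ?M" by (simp add: used_def)
        have "\<exists>n. grounded T (used ?M) n c" if c: "c \<in> children x \<inter> used ?M" for c
        proof -
          have "c \<noteq> x" using c children_not_self by auto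
          then have "(c, True) \<in> M" using c by (auto simp: used_def)
          then show ?thesis
            using admissibleD(5)[OF adm] grounded_mono[OF _ used_mono[of M ?M]] by blast
        qed
        moreover have "tokens T (used ?M) x \<noteq> {}"
          using xQ tok by (auto simp: Q_def)
        ultimately have "\<exists>n. grounded T (used ?M) n x"
          using grounded_token[OF xF] by blast
        moreover have "balanced T (used ?M) x"
          using xQ xF tok by (simp add: Q_def balanced_def)
        ultimately show ?thesis using y xV ch by auto
      qed
    qed
    then have "?M = M" using max by blast
    then show False using xV by auto
  qed

  text \<open>
    In \<open>B\<close>, a parity defect is passed on to the child \<open>s x\<close> that leads to a nearest proper descendant
    in \<open>Q\<close>, where it cancels.
  \<close>
  define near where "near x n \<longleftrightarrow> (\<exists>q\<in>Q. (x, q) \<in> ch ^^ n)" for x n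
  \<comment> \<open>\<open>Suc\<close> forces a proper descendant, so \<open>k x\<close> is the
    distance that remains after the first step and may be \<open>0\<close>.\<close>
  define k where "k x = (LEAST n. near x (Suc n))" for x
  have "\<exists>c. (x, c) \<in> ch \<and> near c (k x)" if x: "x \<in> B" for x
  proof -
    obtain c where c: "(x, c) \<in> ch" using B_child[OF x] by blast
    then have "c \<in> B" by (simp add: ch_def)
    then obtain q where "q \<in> Q" "(c, q) \<in> ch\<^sup>*" using reaches_Q by blast
    then obtain n where "(c, q) \<in> ch ^^ n" using rtrancl_power by metis
    then have "(x, q) \<in> ch ^^ Suc n" using c by (blast intro: relpow_Suc_I2)
    then have "near x (Suc n)" using \<open>q \<in> Q\<close> by (auto simp: near_def)
    then have "near x (Suc (k x))" unfolding k_def by (rule LeastI)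
    then show ?thesis unfolding near_def using relpow_Suc_D2 by metis
  qed
  then obtain s where s: "\<And>x. x \<in> B \<Longrightarrow> (x, s x) \<in> ch \<and> near (s x) (k x)" by metis
  have sB: "s x \<in> B" "s x \<in> children x" if "x \<in> B" for x
    using s[OF that] by (auto simp: ch_def)
  \<comment> \<open>A nearest element of \<open>Q\<close> below \<open>x\<close> is then also
    properly below \<open>s x\<close>, one step closer.\<close>
  have k_less: "k (s x) < k x" if x: "x \<in> B" and nQ: "s x \<notin> Q" for x
  proof -
    obtain q where q: "q \<in> Q" "(s x, q) \<in> ch ^^ k x" using s[OF x] by (auto simp: near_def)
    then obtain j where j: "k x = Suc j" using nQ by (cases "k x") auto
    then have "near (s x) (Suc j)" using q by (auto simp: near_def)
    then have "k (s x) \<le> j" unfolding k_def by (rule Least_le)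
    then show ?thesis using j by simp
  qed

  \<comment> \<open>With the tokens from \<open>M\<close> alone, the parity at \<open>p x\<close> is
    wrong exactly if \<open>h (p x)\<close> differs from \<open>p x \<in> Q\<close>; then one more
    token, the chosen child, corrects it.\<close>
  obtain h where h_root: "\<not> h r"
    and h: "\<And>x. x \<in> V \<Longrightarrow> x \<noteq> r \<Longrightarrow> h x = (x = s (p x) \<and> h (p x) \<noteq> (p x \<in> Q))"
    using parent_recursion[of "\<lambda>x b. x = s (p x) \<and> b \<noteq> (p x \<in> Q)"] by blast
  define F where "F = ?F \<union> {x \<in> B. h x}"
  have F_A: "x \<in> F \<longleftrightarrow> x \<in> ?F" if "x \<in> ?A" for x using that by (auto simp: F_def B_def)
  have F_B: "x \<in> F \<longleftrightarrow> h x" if "x \<in> B" for x using that FA by (auto simp: F_def B_def)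
  have "balanced T F x" if xV: "x \<in> V" for x
  proof (cases "x \<in> ?A")
    case True
    then obtain b where b: "(x, b) \<in> M" by auto
    have "children x \<subseteq> ?A" using admissibleD(3)[OF adm b] .
    then have "tokens T F x = tokens T ?F x" using F_A by (auto simp: tokens_def)
    then show ?thesis
      using admissibleD(4)[OF adm b] F_A[OF True] by (simp add: balanced_def)
  next
    case False
    then have xB: "x \<in> B" using xV by (simp add: B_def)
    have hc: "h c \<longleftrightarrow> c = s x \<and> h x \<noteq> (x \<in> Q)" if "c \<in> children x" for c
      using h[of c] that by (auto simp: children_def)
    have new: "s x \<notin> tokens T ?F x"
      using sB[OF xB] FA children_not_self[of x] by (auto simp: tokens_def B_def)
    have tok: "tokens T F x = tokens T ?F x \<union> (if h x \<noteq> (x \<in> Q) then {s x} else {})"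
    proof -
      have "children x \<inter> F = children x \<inter> ?F \<union> {c \<in> children x \<inter> B. h c}"
        by (auto simp: F_def)
      also have "{c \<in> children x \<inter> B. h c} = (if h x \<noteq> (x \<in> Q) then {s x} else {})"
        using hc sB[OF xB] by auto
      finally show ?thesis by (auto simp: tokens_def)
    qed
    have "odd (card (tokens T F x)) \<longleftrightarrow> h x" if "finite (tokens T F x)"
    proof -
      have "finite (tokens T ?F x)" using that tok by (auto intro: finite_subset)
      moreover from this have "x \<in> Q \<longleftrightarrow> odd (card (tokens T ?F x))"
        using xB by (simp add: Q_def)
      ultimately show ?thesis using new unfolding tok by simp
    qed
    then show ?thesis using F_B[OF xB] by (simp add: balanced_def)
  qed
  moreover have "F \<subseteq> V" using FA AV by (auto simp: F_def B_def)
  moreover have ground_A: "\<exists>n. grounded T F n x" if "x \<in> ?F" for x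
  proof -
    have "(x, True) \<in> M" using that by (simp add: used_def)
    then obtain n where "grounded T ?F n x" using admissibleD(5)[OF adm _ TrueI] by blast
    then have "grounded T F n x" by (rule grounded_mono) (simp add: F_def)
    then show ?thesis ..
  qed
  \<comment> \<open>An odd number of tokens from \<open>M\<close> means at least one, and it is
    grounded independently of \<open>h\<close>.\<close>
  have ground_Q: "\<exists>n. grounded T F n x" if "x \<in> Q" "x \<in> F" for x
  proof -
    have "tokens T ?F x \<noteq> {}" using that(1) by (auto simp: Q_def)
    then consider "x \<in> T" | c where "c \<in> children x" "c \<in> ?F" by (auto simp: tokens_def)
    then show ?thesis
      using that(2) ground_A by cases (blast intro: grounded.intros)+
  qed
  \<comment> \<open>Outside \<open>Q\<close> a used parent edge forces the edge to
    \<open>s x\<close> to be used as well, so the descent follows \<open>s\<close>, with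
    \<open>k\<close> decreasing, until it meets \<open>Q\<close>.\<close>
  have "\<exists>n. grounded T F n x" if "x \<in> B" "h x" for x
    using that
  proof (induction "k x" arbitrary: x rule: less_induct)
    case less
    have xF: "x \<in> F" using less.prems F_B by blast
    show ?case
    proof (cases "x \<in> Q")
      case False
      note sx = sB[OF less.prems(1)]
      have "h (s x)"
        using sx(2) h[of "s x"] less.prems(2) False by (auto simp: children_def)
      then have "\<exists>n. grounded T F n (s x)"
        using less.hyps[OF k_less[OF less.prems(1)]] ground_Q[of "s x"] F_B[OF sx(1)] sx(1) by blast
      then show ?thesis using grounded.step[OF xF sx(2)] by blast
    qed (use xF ground_Q in blast)
  qed
  then have "\<exists>n. grounded T F n x" if "x \<in> F" for x
    using that ground_A by (auto simp: F_def)
  ultimately show thesis using that by blast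
qed

text \<open>If the choice asks for a parent edge at the root, dropping it and toggling
  \<open>r\<close> in \<open>T\<close> both flip the parity at \<open>r\<close>. Other vertices are
  unaffected, as \<open>r\<close> is nobody's child.\<close>

lemma rooted_choice_exists:
  obtains T' F where "T' = T \<or> T' = sym_diff T {r}" "F \<subseteq> V - {r}"
    "\<forall>x\<in>V. balanced T' F x" "\<forall>x\<in>F. \<exists>n. grounded T' F n x"
proof -
  obtain F where F: "F \<subseteq> V" "\<And>x. x \<in> V \<Longrightarrow> balanced T F x" "\<And>x. x \<in> F \<Longrightarrow> \<exists>n. grounded T F n x"
    using balanced_choice_exists by blast
  show thesis
  proof (cases "r \<in> F")
    case False
    then show thesis using that[of T F] F by blast
  next
    case True
    let ?T = "sym_diff T {r}" and ?F = "F - {r}"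
    have ch: "children x \<inter> ?F = children x \<inter> F" for x by (auto simp: children_def)
    have "balanced ?T ?F x" if "x \<in> V" for x
    proof (cases "x = r")
      case False
      then have "tokens ?T ?F x = tokens T F x" unfolding tokens_def ch by auto
      then show ?thesis using F(2)[OF that] False by (simp add: balanced_def)
    next
      case True
      let ?C = "children r \<inter> F"
      have r: "r \<notin> ?C" by (auto simp: children_def)
      have "finite ?C \<Longrightarrow> odd (card (?C \<union> {r} \<inter> T))"
        using F(2)[OF root] \<open>r \<in> F\<close> by (simp add: balanced_def tokens_def)
      then have "finite ?C \<Longrightarrow> even (card (?C \<union> {r} \<inter> ?T))"
        using r by (cases "r \<in> T") auto
      then show ?thesis unfolding True balanced_def tokens_def ch by simp
    qed
    moreover have "grounded ?T ?F n x" if "grounded T F n x" "x \<noteq> r" for n x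
      using that by induction (auto intro!: grounded.intros simp: children_def)
    ultimately show thesis using that[of ?T ?F] F by blast
  qed
qed

end

section \<open>Joins along a spanning tree\<close>

text \<open>For infinite \<open>A\<close>, a bijection from two copies of \<open>A\<close> onto
  \<open>A\<close> pairs the images of the copies of each element; for finite \<open>A\<close>, two
  elements are split off at a time.\<close>

lemma partition_into_pairs:
  assumes "infinite A \<or> even (card A)"
  shows "\<exists>P. \<Union>P = A \<and> pairwise disjnt P \<and> (\<forall>X\<in>P. card X = 2)"
proof (cases "finite A")
  case False
  then have "\<exists>f. bij_betw f (A <+> A) A"
    unfolding card_of_ordIso by (intro card_of_Plus_infinite1 card_of_mono1) simp_all
  then obtain f where f: "bij_betw f (A <+> A) A" by blast
  let ?P = "(\<lambda>a. {f (Inl a), f (Inr a)}) ` A"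
  have inj: "f x = f y \<longleftrightarrow> x = y" if "x \<in> A <+> A" "y \<in> A <+> A" for x y
    using f that by (auto simp: bij_betw_def inj_on_def)
  have "\<Union>?P = f ` (A <+> A)" by (auto simp: Plus_def)
  then have "\<Union>?P = A" using f by (simp add: bij_betw_def)
  moreover have "pairwise disjnt ?P"
    using inj by (auto simp: pairwise_def disjnt_def)
  moreover have "\<forall>X\<in>?P. card X = 2"
  proof
    fix X assume "X \<in> ?P"
    then obtain a where "a \<in> A" "X = {f (Inl a), f (Inr a)}" by blast
    then show "card X = 2" using inj[of "Inl a" "Inr a"] by (simp add: InlI InrI)
  qed
  ultimately show ?thesis by blast
next
  case True
  then have "even (card A)" using assms by simp
  with True show ?thesis
  proof (induction "card A" arbitrary: A rule: less_induct)
    case less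
    show ?case
    proof (cases "A = {}")
      case True
      then show ?thesis by (intro exI[of _ "{}"]) auto
    next
      case False
      then obtain a where a: "a \<in> A" by blast
      have "A \<noteq> {a}" using less.prems(2) by auto
      then obtain b where b: "b \<in> A" "b \<noteq> a" using a by blast
      let ?A = "A - {a, b}"
      have A: "A = insert a (insert b ?A)" using a b by auto
      have "card (insert a (insert b ?A)) = card ?A + 2"
        using b(2) less.prems(1) by (simp del: Diff_insert)
      then have card: "card A = card ?A + 2" by (simp only: A[symmetric])
      then obtain P where P: "\<Union>P = ?A" "pairwise disjnt P" "\<forall>X\<in>P. card X = 2"
        using less.hyps[of ?A] less.prems by auto
      have "pairwise disjnt (insert {a, b} P)"
      proof -
        have "disjnt {a, b} X \<and> disjnt X {a, b}" if "X \<in> P" for X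
          using P(1) that by (auto simp: disjnt_def)
        then show ?thesis using P(2) by (simp add: pairwise_insert)
      qed
      moreover have "\<Union>(insert {a, b} P) = insert a (insert b ?A)" using P(1) by auto
      then have "\<Union>(insert {a, b} P) = A" by (simp only: A[symmetric])
      ultimately show ?thesis using P(3) b(2) by (intro exI[of _ "insert {a, b} P"]) auto
    qed
  qed
qed

text \<open>\<open>e x\<close> is the parent edge of \<open>x\<close>; by injectivity, disjoint sets
  of lower endvertices give disjoint sets of edges.\<close>

locale graph_tree = rooted_tree "verts G" r p d
  for G :: "('v, 'e) multigraph" and r p d +
  fixes e :: "'v \<Rightarrow> 'e"
  assumes tree_edge: "x \<in> verts G \<Longrightarrow> x \<noteq> r \<Longrightarrow> e x \<in> edges G \<and> ends G (e x) = {x, p x}"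
    and inj_e: "inj_on e (verts G - {r})"
begin

text \<open>Each path will consist of two descending branches, one possibly trivial, that meet at
  its topmost vertex. \<open>bal\<close> lets the branches arriving at a vertex be paired, and
  \<open>ground\<close> makes them finite.\<close>

lemma balanced_joinable:
  assumes T: "T \<subseteq> verts G" and F: "F \<subseteq> verts G - {r}"
    and bal: "\<And>x. x \<in> verts G \<Longrightarrow> balanced T F x"
    and ground: "\<And>x. x \<in> F \<Longrightarrow> \<exists>n. grounded T F n x"
  shows "joinable G (edges G) T"
proof -
  let ?tok = "tokens T F"
  have dF: "p x \<in> verts G" "d (p x) < d x" "x \<in> children (p x)" if "x \<in> F" for x
    using parent[of x] F that by (auto simp: children_def)
  have childF: "p c = x" "c \<noteq> x" if "c \<in> children x" for c x
    using that parent[of c] by (auto simp: children_def)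

  \<comment> \<open>\<open>g\<close> is the length of a shortest descent to \<open>T\<close>;
    letting \<open>u\<close> lower it makes the descent along \<open>u\<close> terminate.\<close>
  define g where "g x = (LEAST n. grounded T F n x)" for x
  have "\<exists>c. (x \<in> T \<and> c = x) \<or> (x \<notin> T \<and> c \<in> children x \<inter> F \<and> g c < g x)" if "x \<in> F" for x
  proof (cases "x \<in> T")
    case False
    have "grounded T F (g x) x" unfolding g_def using ground[OF that] by (rule LeastI_ex)
    then obtain c n where c: "c \<in> children x" "grounded T F n c" "g x = Suc n"
      using False by (auto elim: grounded.cases)
    have "g c \<le> n" unfolding g_def using c(2) by (rule Least_le)
    then show ?thesis using False c grounded_in[OF c(2)] by auto
  qed auto
  then obtain u where u: "\<And>x. x \<in> F \<Longrightarrow>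
      (x \<in> T \<and> u x = x) \<or> (x \<notin> T \<and> u x \<in> children x \<inter> F \<and> g (u x) < g x)"
    by metis

  text \<open>
    If the parent edge of \<open>x\<close> is used, then \<open>u x\<close> is the token that continues upwards; the remaining
    tokens are paired at \<open>x\<close>.
  \<close>
  define rest where "rest x = ?tok x - (if x \<in> F then {u x} else {})" for x
  have "infinite (rest x) \<or> even (card (rest x))" if x: "x \<in> verts G" for x
  proof (cases "x \<in> F")
    case True
    then have "u x \<in> ?tok x" using u[OF True] by (auto simp: tokens_def)
    then show ?thesis
      using bal[OF x] True by (auto simp: rest_def balanced_def)
  qed (use bal[OF x] in \<open>auto simp: rest_def balanced_def\<close>)
  then have "\<forall>x\<in>verts G. \<exists>P. \<Union>P = rest x \<and> pairwise disjnt P \<and> (\<forall>X\<in>P. card X = 2)"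
    using partition_into_pairs by blast
  then obtain P where P: "\<And>x. x \<in> verts G \<Longrightarrow>
      \<Union>(P x) = rest x \<and> pairwise disjnt (P x) \<and> (\<forall>X\<in>P x. card X = 2)"
    by metis
  have restD: "a = x \<and> x \<in> T \<or> a \<noteq> x \<and> a \<in> F \<and> p a = x \<and> a \<in> rest (p a)" if "a \<in> rest x" for a x
    using that childF by (auto simp: rest_def tokens_def)

  \<comment> \<open>\<open>W a\<close> is the branch below \<open>a\<close>: it traces the tokens
    passed upwards back down and stops in \<open>T\<close>, where that token is the vertex
    itself.\<close>
  define U where "U = {(x, u x) | x. x \<in> F \<and> x \<notin> T}"
  define W where "W a = U\<^sup>* `` {a}" for a
  have W_F: "y \<in> F" if "y \<in> W a" "a \<in> F" for a y
  proof -
    have "(a, y) \<in> U\<^sup>*" using that by (simp add: W_def)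
    then show ?thesis using that(2) u by induction (auto simp: U_def)
  qed
  have W_up: "p y \<in> F \<and> p y \<notin> T \<and> u (p y) = y \<and> p y \<in> W a" if y: "y \<in> W a" "y \<noteq> a" for a y
  proof -
    have "(a, y) \<in> U\<^sup>*" using y(1) by (simp add: W_def)
    then obtain z where z: "(a, z) \<in> U\<^sup>*" "(z, y) \<in> U"
      using y(2) by (metis rtranclE)
    then have zF: "z \<in> F" "z \<notin> T" "y = u z" by (auto simp: U_def)
    then have "p y = z" using u[OF zF(1)] childF(1)[of y z] by blast
    then show ?thesis using z(1) zF by (simp add: W_def)
  qed
  \<comment> \<open>Climbing from a common vertex, both branches continue to its parent until a top
    is met. A top is not the token passed upwards at its parent, so neither branch goes beyond
    it.\<close>
  have top_unique: "a = b"
    if "y \<in> W a" "y \<in> W b" "a \<in> F" "b \<in> F" "a \<in> rest (p a)" "b \<in> rest (p b)" for a b y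
    using that
  proof (induction "d y" arbitrary: y rule: less_induct)
    case less
    have "y \<in> F" using W_F less.prems by blast
    have notW: "y = b" if "y = a"
    proof (rule ccontr)
      assume "y \<noteq> b"
      then show False using W_up[OF less.prems(2)] less.prems(5) that by (simp add: rest_def)
    qed
    have notW': "y = a" if "y = b"
    proof (rule ccontr)
      assume "y \<noteq> a"
      then show False using W_up[OF less.prems(1)] less.prems(6) that by (simp add: rest_def)
    qed
    show ?case
    proof (cases "y = a \<or> y = b")
      case False
      then show ?thesis
        using less.hyps[of "p y"] dF[OF \<open>y \<in> F\<close>] W_up less.prems by blast
    qed (use notW notW' in blast)
  qed
  \<comment> \<open>If \<open>y\<close> is not paired at \<open>p y\<close>, it is the token passed
    upwards there, so the climb continues; it ends because \<open>d\<close> drops.\<close>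
  have top_exists: "\<exists>a\<in>F. y \<in> W a \<and> a \<in> rest (p a)" if "y \<in> F" for y
    using that
  proof (induction "d y" arbitrary: y rule: less_induct)
    case less
    note y = dF[OF less.prems]
    show ?case
    proof (cases "y \<in> rest (p y)")
      case True
      then show ?thesis using less.prems by (auto simp: W_def)
    next
      case False
      then have py: "p y \<in> F" "u (p y) = y"
        using y(3) less.prems by (auto simp: rest_def tokens_def split: if_splits)
      then have "p y \<notin> T" using u[of "p y"] childF(2)[OF y(3)] by auto
      then have "(p y, y) \<in> U" using py by (force simp: U_def)
      moreover obtain a where "a \<in> F" "p y \<in> W a" "a \<in> rest (p a)"
        using less.hyps[OF y(2) py(1)] by blast
      ultimately show ?thesis by (auto simp: W_def intro: rtrancl_into_rtrancl)
    qed
  qed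
  have "\<exists>t. t \<in> W a \<inter> T" if "a \<in> F" for a
    using that
  proof (induction "g a" arbitrary: a rule: less_induct)
    case less
    show ?case
    proof (cases "a \<in> T")
      case True
      then show ?thesis by (auto simp: W_def)
    next
      case False
      then have ua: "u a \<in> F" "g (u a) < g a" using u[OF less.prems] by auto
      have "(a, u a) \<in> U" using False less.prems by (auto simp: U_def)
      then have "W (u a) \<subseteq> W a" by (auto simp: W_def intro: converse_rtrancl_into_rtrancl)
      then show ?thesis using less.hyps[OF ua(2,1)] by blast
    qed
  qed
  then obtain \<tau> where \<tau>: "\<And>a. a \<in> F \<Longrightarrow> \<tau> a \<in> W a \<and> \<tau> a \<in> T" by (metis IntE)
  \<comment> \<open>\<open>U\<close> is single-valued, so the branch is a chain, and no step leaves
    an element of \<open>T\<close>.\<close>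
  have \<tau>_unique: "t = \<tau> a" if "t \<in> W a" "t \<in> T" "a \<in> F" for a t
  proof -
    have "single_valued U" by (auto simp: U_def single_valued_def)
    then have "(t, \<tau> a) \<in> U\<^sup>* \<or> (\<tau> a, t) \<in> U\<^sup>*"
      using that \<tau>[OF that(3)] by (intro single_valued_confluent) (auto simp: W_def)
    moreover have "z = s" if "(s, z) \<in> U\<^sup>*" "s \<in> T" for s z
      using that by (auto simp: U_def elim: converse_rtranclE)
    ultimately show ?thesis using that(2) \<tau>[OF that(3)] by blast
  qed

  text \<open>
    \<open>a \<in> rest x\<close> stands for a path that starts at \<open>org x a\<close>, runs through the parent edges of
    \<open>WW x a\<close> and reaches \<open>x\<close> from its child \<open>a\<close>; the case \<open>a = x\<close> is the trivial path at \<open>x \<in> T\<close>.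
  \<close>
  define org where "org x a = (if a = x then x else \<tau> a)" for x a
  define WW where "WW x a = (if a = x then {} else W a)" for x a
  have org_T: "org x a \<in> T" if "a \<in> rest x" for x a
    using restD[OF that] \<tau> by (auto simp: org_def)
  have WW_F: "WW x a \<subseteq> F" if "a \<in> rest x" for x a
    using restD[OF that] W_F by (auto simp: WW_def)
  have org_inj: "x = y \<and> a = b" if ab: "a \<in> rest x" "b \<in> rest y" "org x a = org y b" for x y a b
  proof -
    \<comment> \<open>If a branch ended at the same vertex \<open>x\<close> as the trivial path,
      then \<open>x\<close> would lie in \<open>F\<close> and \<open>T\<close>, so
      \<open>u x = x\<close> would be passed upwards and not paired at \<open>x\<close>.\<close>
    have self: False if "a \<in> rest x" "b \<in> rest y" "a = x" "b \<noteq> y" "org x a = org y b" for x y a b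
    proof -
      have "x \<in> F" "x \<in> T"
        using that restD[OF that(1)] restD[OF that(2)] \<tau>[of b] W_F by (auto simp: org_def)
      then show False using that(1,3) u[of x] by (auto simp: rest_def)
    qed
    show ?thesis
    proof (cases "a = x \<or> b = y")
      case True
      then show ?thesis using self[OF ab(1,2)] self[OF ab(2,1)] ab(3) by (auto simp: org_def)
    next
      case False
      then have "\<tau> a = \<tau> b" using ab(3) by (simp add: org_def)
      moreover have "a \<in> F" "b \<in> F" "a \<in> rest (p a)" "b \<in> rest (p b)"
        using restD[OF ab(1)] restD[OF ab(2)] False by auto
      ultimately have "a = b" using top_unique[of "\<tau> a" a b] \<tau>[of a] \<tau>[of b] by simp
      then show ?thesis using restD[OF ab(1)] restD[OF ab(2)] False by auto
    qed
  qed
  have WW_disj: "x = y \<and> a = b" if "a \<in> rest x" "b \<in> rest y" "w \<in> WW x a" "w \<in> WW y b" for x y a b w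
  proof -
    have ne: "a \<noteq> x" "b \<noteq> y" using that(3,4) by (auto simp: WW_def split: if_splits)
    then have "a = b"
      using top_unique[of w a b] that restD[OF that(1)] restD[OF that(2)] by (auto simp: WW_def)
    then show ?thesis using ne restD[OF that(1)] restD[OF that(2)] by auto
  qed
  have org_reach: "(org x a, x) \<in> (adj G (e ` WW x a))\<^sup>*" if a: "a \<in> rest x" for x a
  proof (cases "a = x")
    case False
    let ?E = "adj G (e ` W a)"
    have aF: "a \<in> F" "p a = x" using restD[OF a] False by auto
    have up: "(y, p y) \<in> ?E" if "y \<in> W a" for y
      using that W_F[OF that aF(1)] tree_edge[of y] F by (auto simp: adj_def)
    have "(a, \<tau> a) \<in> U\<^sup>*" using \<tau>[OF aF(1)] by (simp add: W_def)
    then have "(\<tau> a, a) \<in> ?E\<^sup>*"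
    proof induction
      case (step y z)
      have "z \<in> W a" using step.hyps by (auto simp: W_def)
      moreover have "p z = y" using step.hyps u[of y] childF by (auto simp: U_def)
      ultimately show ?case using up[of z] step.IH by (auto intro: converse_rtrancl_into_rtrancl)
    qed simp
    moreover have "(a, x) \<in> ?E" using up[of a] aF by (simp add: W_def)
    ultimately show ?thesis using False by (auto simp: org_def WW_def intro: rtrancl_into_rtrancl)
  qed (simp add: org_def)

  \<comment> \<open>An index is a vertex together with one of the pairs of branches meeting
    there.\<close>
  define I where "I = (SIGMA x:verts G. P x)"
  define D where "D = (\<lambda>(x, X). org x ` X)"
  define E where "E = (\<lambda>(x, X). e ` (\<Union>a\<in>X. WW x a))"
  have PR: "a \<in> rest x" if "(x, X) \<in> I" "a \<in> X" for x X a
    using P[of x] that by (auto simp: I_def)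
  have same: "X = Y" if "(x, X) \<in> I" "(x, Y) \<in> I" "a \<in> X" "a \<in> Y" for x X Y a
    using P[of x] that unfolding I_def pairwise_def disjnt_def by blast
  have "joinable G (edges G) (\<Union>i\<in>I. D i)"
  proof (rule joinable_family)
    fix i assume i: "i \<in> I"
    obtain x X where ix: "i = (x, X)" by (cases i)
    have xX: "(x, X) \<in> I" using i ix by simp
    have "inj_on (org x) X"
      by (rule inj_onI) (use org_inj[OF PR[OF xX] PR[OF xX]] in blast)
    then have "card (D i) = 2" using P[of x] xX by (simp add: ix D_def card_image I_def)
    moreover have "D i \<subseteq> verts G" using PR[OF xX] org_T T by (auto simp: ix D_def)
    moreover have "WW x a \<subseteq> F" if "a \<in> X" for a using WW_F PR[OF xX that] by blast
    then have "E i \<subseteq> e ` F" by (auto simp: ix E_def)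
    then have "E i \<subseteq> edges G" using F tree_edge by blast
    moreover have "(org x a, x) \<in> (adj G (E i))\<^sup>*" if "a \<in> X" for a
      using org_reach[OF PR[OF xX that]] that by (auto simp: ix E_def elim!: reach_mono)
    then have "(org x a, org x b) \<in> (adj G (E i))\<^sup>*" if "a \<in> X" "b \<in> X" for a b
      using that reach_sym rtrancl_trans by metis
    then have "\<forall>s\<in>D i. \<forall>t\<in>D i. (s, t) \<in> (adj G (E i))\<^sup>*" by (auto simp: ix D_def)
    ultimately show "linked G (D i) (E i) \<and> E i \<subseteq> edges G" by (simp add: linked_def)
  next
    fix i j assume ij: "i \<in> I" "j \<in> I" "i \<noteq> j"
    obtain x X where ix: "i = (x, X)" by (cases i)
    obtain y Y where jy: "j = (y, Y)" by (cases j)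
    have xX: "(x, X) \<in> I" "(y, Y) \<in> I" using ij ix jy by auto
    have no: "\<not> (x = y \<and> a = b)" if "a \<in> X" "b \<in> Y" for a b
    proof
      assume "x = y \<and> a = b"
      then have "X = Y" using same[OF xX(1) _ that(1)] xX(2) that(2) by blast
      then show False using \<open>x = y \<and> a = b\<close> ij(3) ix jy by blast
    qed
    have "D i \<inter> D j = {}"
    proof (rule equals0I)
      fix t assume "t \<in> D i \<inter> D j"
      then obtain a b where ab: "a \<in> X" "b \<in> Y" "org x a = org y b"
        by (auto simp: ix jy D_def)
      then show False
        using org_inj[OF PR[OF xX(1) ab(1)] PR[OF xX(2) ab(2)] ab(3)] no[OF ab(1,2)] by blast
    qed
    moreover have ww: "e w \<noteq> e w'" if "a \<in> X" "b \<in> Y" "w \<in> WW x a" "w' \<in> WW y b" for a b w w'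
    proof
      assume eq: "e w = e w'"
      have "w \<in> F" "w' \<in> F" using WW_F PR xX that by blast+
      then have "w = w'" using inj_onD[OF inj_e eq] F by auto
      then show False using WW_disj[OF PR[OF xX(1) that(1)] PR[OF xX(2) that(2)] that(3)] that(4) no[OF that(1,2)] by blast
    qed
    have "E i \<inter> E j = {}"
    proof (rule equals0I)
      fix f assume "f \<in> E i \<inter> E j"
      then obtain a w b w' where "a \<in> X" "w \<in> WW x a" "f = e w" "b \<in> Y" "w' \<in> WW y b" "f = e w'"
        by (auto simp: ix jy E_def)
      then show False using ww by blast
    qed
    ultimately show "D i \<inter> D j = {} \<and> E i \<inter> E j = {}" ..
  qed
  moreover have "(\<Union>i\<in>I. D i) = T"
  proof
    show "(\<Union>i\<in>I. D i) \<subseteq> T" using PR org_T by (auto simp: D_def)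
    show "T \<subseteq> (\<Union>i\<in>I. D i)"
    proof
      fix t assume t: "t \<in> T"
      \<comment> \<open>A vertex of \<open>T\<close> is either paired at itself, as a trivial
        branch, or passed upwards and then the end of the branch containing it.\<close>
      have "\<exists>x a. x \<in> verts G \<and> a \<in> rest x \<and> org x a = t"
      proof (cases "t \<in> rest t")
        case True
        then show ?thesis using t T by (auto simp: org_def)
      next
        case False
        then have "t \<in> F" using t by (auto simp: rest_def tokens_def split: if_splits)
        then obtain a where a: "a \<in> F" "t \<in> W a" "a \<in> rest (p a)" using top_exists[of t] by blast
        have "org (p a) a = t"
          using \<tau>_unique[OF a(2) t a(1)] childF(2)[OF dF(3)[OF a(1)]] by (simp add: org_def)
        then show ?thesis using a(3) dF(1)[OF a(1)] by blast
      qed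
      then obtain x a where x: "x \<in> verts G" "a \<in> rest x" "org x a = t" by blast
      then obtain X where X: "X \<in> P x" "a \<in> X" using P[OF x(1)] by blast
      have "t \<in> D (x, X)" using X(2) x(3) by (auto simp: D_def)
      moreover have "(x, X) \<in> I" using X(1) x(1) by (simp add: I_def)
      ultimately show "t \<in> (\<Union>i\<in>I. D i)" by blast
    qed
  qed
  ultimately show ?thesis by simp
qed

lemma tree_dichotomy:
  assumes "T \<subseteq> verts G"
  shows "joinable G (edges G) T \<or> joinable G (edges G) (sym_diff T {r})"
proof -
  obtain T' F where F: "T' = T \<or> T' = sym_diff T {r}" "F \<subseteq> verts G - {r}"
    "\<forall>x\<in>verts G. balanced T' F x" "\<forall>x\<in>F. \<exists>n. grounded T' F n x"
    using rooted_choice_exists[of T] .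
  have "sym_diff T {r} \<subseteq> verts G" using assms root by blast
  then have "T' \<subseteq> verts G" using F(1) assms by metis
  then have "joinable G (edges G) T'" using balanced_joinable F(2-4) by simp
  then show ?thesis using F(1) by metis
qed

end

text \<open>The breadth-first tree takes as parent of a vertex a neighbour closer to
  \<open>r\<close>, with one chosen edge to it.\<close>

lemma has_join_or_toggle:
  assumes G: "connected_multigraph G" and T: "T \<subseteq> verts G" and r: "r \<in> verts G"
  shows "has_join G T \<or> has_join G (sym_diff T {r})"
proof -
  have wf: "wf_multigraph G" using G by (simp add: connected_multigraph_def)
  let ?R = "adj G (edges G)"
  define d where "d x = (LEAST n. (r, x) \<in> ?R ^^ n)" for x
  have dist: "(r, x) \<in> ?R ^^ d x" if x: "x \<in> verts G" for x
  proof -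
    obtain n where "(r, x) \<in> ?R ^^ n"
      using connected_reach[OF G r x] rtrancl_power by metis
    then show ?thesis unfolding d_def by (rule LeastI)
  qed
  have "\<exists>y f. f \<in> edges G \<and> ends G f = {x, y} \<and> y \<in> verts G \<and> d y < d x"
    if x: "x \<in> verts G" "x \<noteq> r" for x
  proof -
    obtain n where n: "d x = Suc n" using dist[OF x(1)] x(2) by (cases "d x") auto
    then obtain y where y: "(r, y) \<in> ?R ^^ n" "(y, x) \<in> ?R" using dist[OF x(1)] by auto
    then obtain f where f: "f \<in> edges G" "ends G f = {x, y}" by (auto simp: adj_def)
    moreover have "d y \<le> n" unfolding d_def using y(1) by (rule Least_le)
    moreover have "y \<in> verts G" using wf f by (auto simp: wf_multigraph_def)
    ultimately show ?thesis using n le_imp_less_Suc by metis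
  qed
  then obtain p e where pe: "\<And>x. x \<in> verts G \<Longrightarrow> x \<noteq> r \<Longrightarrow>
      e x \<in> edges G \<and> ends G (e x) = {x, p x} \<and> p x \<in> verts G \<and> d (p x) < d x"
    by metis
  \<comment> \<open>Two vertices with a common parent edge would be each other's parents, so
    \<open>d\<close> would drop both ways.\<close>
  have "inj_on e (verts G - {r})"
  proof (rule inj_onI)
    fix x y assume xy: "x \<in> verts G - {r}" "y \<in> verts G - {r}" "e x = e y"
    then have "{x, p x} = {y, p y}" using pe by (metis DiffE singletonI)
    then show "x = y" using pe[of x] pe[of y] xy by (auto simp: doubleton_eq_iff)
  qed
  then interpret graph_tree G r p d e
  proof unfold_locales
    show "p x \<in> verts G \<and> d (p x) < d x" if "x \<in> verts G" "x \<noteq> r" for x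
      using pe[OF that] by blast
    show "e x \<in> edges G \<and> ends G (e x) = {x, p x}" if "x \<in> verts G" "x \<noteq> r" for x
      using pe[OF that] by blast
  qed (use r in blast)
  show ?thesis using tree_dichotomy[OF T] has_join_iff_joinable[OF wf] by simp
qed

section \<open>The three classes\<close>

lemma sym_diff_parity:
  assumes "finite (sym_diff T T')"
  shows "finite (sym_diff (sym_diff T {v}) T')"
    and "even (card (sym_diff (sym_diff T {v}) T')) \<longleftrightarrow> odd (card (sym_diff T T'))"
proof -
  let ?S = "sym_diff T T'" and ?S' = "sym_diff (sym_diff T {v}) T'"
  have "(v \<notin> ?S \<and> ?S' = insert v ?S) \<or> (v \<notin> ?S' \<and> ?S = insert v ?S')" by auto
  then show fin: "finite ?S'" using assms by (metis finite_insert)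
  from assms fin show "even (card ?S') \<longleftrightarrow> odd (card ?S)"
    using \<open>(v \<notin> ?S \<and> ?S' = insert v ?S) \<or> (v \<notin> ?S' \<and> ?S = insert v ?S')\<close>
    by (metis card_insert_disjoint even_Suc)
qed

lemma has_join_even:
  assumes G: "connected_multigraph G" and T: "T \<subseteq> verts G"
    and T': "T' \<subseteq> verts G" "finite (sym_diff T T')" "even (card (sym_diff T T'))"
  shows "has_join G T' \<longleftrightarrow> has_join G T"
proof -
  have "sym_diff T' T = sym_diff T T'" by auto
  then show ?thesis
    using has_join_even_change[OF G _ T'] has_join_even_change[OF G _ T, of T'] T' by metis
qed

context
  fixes G :: "('v, 'e) multigraph" and T v
  assumes G: "connected_multigraph G" and T: "T \<subseteq> verts G" and v: "v \<in> verts G"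
begin

lemma toggle_subset: "sym_diff T {v} \<subseteq> verts G"
  using T v by auto

text \<open>A set differing from \<open>T\<close> in an odd number of vertices differs from
  \<open>sym_diff T {v}\<close> in an even number, so this one set stands for all odd
  changes.\<close>

lemma has_join_odd:
  assumes "T' \<subseteq> verts G" "finite (sym_diff T T')" "odd (card (sym_diff T T'))"
  shows "has_join G T' \<longleftrightarrow> has_join G (sym_diff T {v})"
proof -
  let ?S = "sym_diff T {v}"
  have "sym_diff T' ?S = sym_diff ?S T'" by auto
  then show ?thesis
    using has_join_even_change[OF G _ assms(1), of ?S] has_join_even_change[OF G _ toggle_subset, of T']
      sym_diff_parity[OF assms(2), of v] assms(3) by metis
qed

lemma sym_diff_toggle: "sym_diff T (sym_diff T {v}) = {v}"
  by auto

lemma property_A_iff: "property_A G T \<longleftrightarrow> has_join G T \<and> has_join G (sym_diff T {v})"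
proof
  assume A: "property_A G T"
  have "has_join G T" using A T by (simp add: property_A_def)
  moreover have "has_join G (sym_diff T {v})"
    using A toggle_subset sym_diff_toggle unfolding property_A_def by (metis finite.emptyI finite.insertI)
  ultimately show "has_join G T \<and> has_join G (sym_diff T {v})" ..
next
  assume "has_join G T \<and> has_join G (sym_diff T {v})"
  then show "property_A G T" unfolding property_A_def using has_join_even[OF G T] has_join_odd by blast
qed

lemma property_B_iff: "property_B G T \<longleftrightarrow> has_join G T \<and> \<not> has_join G (sym_diff T {v})"
proof
  assume B: "property_B G T"
  have "has_join G T" using B T by (simp add: property_B_def)
  moreover have "\<not> has_join G (sym_diff T {v})"
    using B[unfolded property_B_def, rule_format, OF toggle_subset] unfolding sym_diff_toggle by simp
  ultimately show "has_join G T \<and> \<not> has_join G (sym_diff T {v})" ..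
next
  assume "has_join G T \<and> \<not> has_join G (sym_diff T {v})"
  then show "property_B G T" unfolding property_B_def using has_join_even[OF G T] has_join_odd by blast
qed

lemma property_C_iff: "property_C G T \<longleftrightarrow> \<not> has_join G T \<and> has_join G (sym_diff T {v})"
proof
  assume C: "property_C G T"
  have "\<not> has_join G T" using C T by (simp add: property_C_def)
  moreover have "has_join G (sym_diff T {v})"
    using C[unfolded property_C_def, rule_format, OF toggle_subset] unfolding sym_diff_toggle by simp
  ultimately show "\<not> has_join G T \<and> has_join G (sym_diff T {v})" ..
next
  assume "\<not> has_join G T \<and> has_join G (sym_diff T {v})"
  then show "property_C G T" unfolding property_C_def using has_join_even[OF G T] has_join_odd by blast
qed

end

text \<open>The properties record which of \<open>T\<close> and \<open>sym_diff T {v}\<close> have a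
  join; \<open>has_join_or_toggle\<close> excludes that neither does.\<close>

lemma trichotomy:
  assumes G: "connected_multigraph G" and T: "T \<subseteq> verts G"
  shows "(property_A G T \<and> \<not> property_B G T \<and> \<not> property_C G T) \<or>
      (\<not> property_A G T \<and> property_B G T \<and> \<not> property_C G T) \<or>
      (\<not> property_A G T \<and> \<not> property_B G T \<and> property_C G T)"
proof -
  obtain v where v: "v \<in> verts G" using G by (auto simp: connected_multigraph_def)
  show ?thesis
    using has_join_or_toggle[OF G T v] property_A_iff[OF G T v] property_B_iff[OF G T v]
      property_C_iff[OF G T v] by blast
qed

section \<open>Examples for the three classes\<close>

lemma has_join_empty: "has_join G {}"
  unfolding has_join_def is_join_def by (rule exI[of _ "{}"]) simp

text \<open>Example for \<open>property_B\<close> with the empty set and for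
  \<open>property_C\<close> with its only vertex.\<close>

definition point_graph :: "(nat, nat) multigraph" where
  "point_graph = \<lparr>verts = {0}, edges = {}, ends = \<lambda>_. {}\<rparr>"

lemma point_connected: "connected_multigraph point_graph"
proof -
  have "path_in point_graph ([0], [])" "endvertices ([0 :: nat], [] :: nat list) = {0, 0}"
    by (auto simp: path_in_def point_graph_def endvertices_def)
  then show ?thesis
    unfolding connected_multigraph_def by (auto simp: wf_multigraph_def point_graph_def)
qed

lemma point_no_join: "\<not> has_join point_graph {0}"
proof
  assume "has_join point_graph {0}"
  then obtain P where P: "is_join point_graph {0} P" by (auto simp: has_join_def)
  then obtain p where "p \<in> P" by (auto simp: is_join_def)
  with P have "endvertices p \<subseteq> {0}" "card (endvertices p) = 2" by (simp_all add: is_join_def)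
  then show False using card_mono[of "{0 :: nat}" "endvertices p"] by simp
qed

text \<open>Example for \<open>property_A\<close>: a parity defect can be pushed off to
  infinity.\<close>

definition ray :: "(nat, nat) multigraph" where
  "ray = \<lparr>verts = UNIV, edges = UNIV, ends = \<lambda>n. {n, Suc n}\<rparr>"

lemma ray_wf: "wf_multigraph ray"
  by (simp add: wf_multigraph_def ray_def)

lemma ray_connected: "connected_multigraph ray"
  unfolding connected_multigraph_def
proof (intro conjI ballI)
  have up: "(0, n) \<in> (adj ray (edges ray))\<^sup>*" for n
  proof (induction n)
    case (Suc n)
    moreover have "(n, Suc n) \<in> adj ray (edges ray)" by (auto simp: adj_def ray_def)
    ultimately show ?case by (rule rtrancl_into_rtrancl)
  qed simp
  fix u v assume "u \<in> verts ray"
  have "(u, v) \<in> (adj ray (edges ray))\<^sup>*"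
    using reach_sym[OF up[of u]] up[of v] by (rule rtrancl_trans)
  then obtain vs es where "path_in ray (vs, es)" "hd vs = u" "last vs = v"
    using reach_path[OF ray_wf subset_refl \<open>u \<in> verts ray\<close>] by metis
  then show "\<exists>p. path_in ray p \<and> endvertices p = {u, v}"
    by (intro exI[of _ "(vs, es)"]) (simp add: endvertices_def)
qed (use ray_wf in \<open>simp_all add: ray_def\<close>)

text \<open>Consecutive vertices are paired by single edges. The cases \<open>k = 0\<close> and
  \<open>k = 1\<close> differ in one vertex, which is what \<open>property_A_iff\<close> asks
  for.\<close>

lemma ray_join: "has_join ray {k..}"
proof -
  let ?D = "\<lambda>i. {k + 2 * i, Suc (k + 2 * i)}" and ?E = "\<lambda>i. {k + 2 * i}"
  have "joinable ray (edges ray) (\<Union>i\<in>UNIV. ?D i)"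
  proof (rule joinable_family)
    fix i :: nat
    show "linked ray (?D i) (?E i) \<and> ?E i \<subseteq> edges ray"
      unfolding linked_pair by (auto simp: adj_def ray_def)
  next
    fix i j :: nat assume "i \<noteq> j"
    then show "?D i \<inter> ?D j = {} \<and> ?E i \<inter> ?E j = {}" by auto
  qed
  moreover have "(\<Union>i\<in>UNIV. ?D i) = {k..}"
  proof (intro equalityI subsetI)
    fix n assume "n \<in> {k..}"
    then have "n \<in> ?D ((n - k) div 2)" by simp presburger
    then show "n \<in> (\<Union>i\<in>UNIV. ?D i)" by blast
  qed auto
  ultimately show ?thesis using has_join_iff_joinable[OF ray_wf] by simp
qed

theorem theorem3:
  "(\<forall>(G :: ('v, 'e) multigraph) T. connected_multigraph G \<and> T \<subseteq> verts G \<longrightarrow>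
      (property_A G T \<and> \<not> property_B G T \<and> \<not> property_C G T) \<or>
      (\<not> property_A G T \<and> property_B G T \<and> \<not> property_C G T) \<or>
      (\<not> property_A G T \<and> \<not> property_B G T \<and> property_C G T)) \<and>
   (\<exists>(G :: (nat, nat) multigraph) T. connected_multigraph G \<and> T \<subseteq> verts G \<and> property_A G T) \<and>
   (\<exists>(G :: (nat, nat) multigraph) T. connected_multigraph G \<and> T \<subseteq> verts G \<and> property_B G T) \<and>
   (\<exists>(G :: (nat, nat) multigraph) T. connected_multigraph G \<and> T \<subseteq> verts G \<and> property_C G T)"
proof (intro conjI)
  have "sym_diff {0..} {0} = {1 :: nat..}" by auto
  then have "property_A ray {0..}"
    using property_A_iff[OF ray_connected, of "{0..}" 0] ray_join[of 0] ray_join[of 1]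
    by (simp add: ray_def)
  then show "\<exists>(G :: (nat, nat) multigraph) T. connected_multigraph G \<and> T \<subseteq> verts G \<and> property_A G T"
    using ray_connected by (intro exI[of _ ray] exI[of _ "{0..}"]) (simp add: ray_def)
  have v: "{} \<subseteq> verts point_graph" "{0} \<subseteq> verts point_graph" "0 \<in> verts point_graph"
    by (simp_all add: point_graph_def)
  have "property_B point_graph {}"
    using property_B_iff[OF point_connected v(1,3)] has_join_empty point_no_join by simp
  then show "\<exists>(G :: (nat, nat) multigraph) T. connected_multigraph G \<and> T \<subseteq> verts G \<and> property_B G T"
    using point_connected v(1) by blast
  have "property_C point_graph {0}"
    using property_C_iff[OF point_connected v(2,3)] has_join_empty[of point_graph] point_no_join by simp
  then show "\<exists>(G :: (nat, nat) multigraph) T. connected_multigraph G \<and> T \<subseteq> verts G \<and> property_C G T"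
    using point_connected v(2) by blast
qed (use trichotomy in blast)

end
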